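(* For every $q=q(n)$ with $q\le O(n^2)$, $$L(n,q)\asymp\frac{n\,2^n}{\log_2 n},$$ i.e. there are constants $0<c_1\le c_2$ such that $c_1\,n2^n/\log_2 n\le L(n,q(n))\le c_2\,n2^n/\log_2 n$ for all sufficiently large $n$.
   Context: For $m\ge1$, a $k$-CNOT gate on $m$ lines with control lines $i_1,\dots,i_k$ and target line $j\notin\{i_1,\dots,i_k\}$ is the map $\mathbb Z_2^m\to\mathbb Z_2^m$ replacing $x_j$ by $x_j\oplus(x_{i_1}\wedge\dots\wedge x_{i_k})$ and leaving other coordinates unchanged; NOT, CNOT, 2-CNOT are the cases $k=0,1,2$. A reversible circuit on $m$ lines is a finite sequence of such gates, computing their composition $g$; its complexity is its number of gates. With $\phi_{n,n+q}(\langle x_1,\dots,x_n\rangle)=\langle x_1,\dots,x_n,0,\dots,0\rangle\in\mathbb Z_2^{n+q}$ and $\psi_{n+q,n}(\langle x_1,\dots,x_{n+q}\rangle)=\langle x_1,\dots,x_n\rangle$, a circuit on $n+q$ lines implements $f\colon\mathbb Z_2^n\to\mathbb Z_2^n$ with $q$ additional inputs if $\psi_{n+q,n}(g(\phi_{n,n+q}(\vec x)))=f(\vec x)$ for all $\vec x$. $F(n,q)$ is the set of maps $\mathbb Z_2^n\to\mathbb Z_2^n$ implementable this way. The Shannon function $L(n,q)$ is the maximum, over all $f\in F(n,q)$, of the minimum complexity of a reversible circuit of NOT, CNOT, 2-CNOT gates implementing $f$ with $q$ additional inputs. *)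

theory Defs
  imports Complex_Main "HOL-Library.Landau_Symbols"
begin

text \<open>Vectors of Z_2^m are represented as bool lists of length m (True = 1, xor = \<noteq>).
  Lines are indexed 0..m-1.  A gate is a pair (C, t): set C of control lines, target t.\<close>

type_synonym gate = "nat set \<times> nat"

definition valid_gate :: "nat \<Rightarrow> gate \<Rightarrow> bool" where
  "valid_gate m g \<longleftrightarrow> (let (C, t) = g in
      C \<subseteq> {..<m} \<and> t < m \<and> t \<notin> C \<and> card C \<le> 2)"

definition apply_gate :: "gate \<Rightarrow> bool list \<Rightarrow> bool list" where
  "apply_gate g xs = (let (C, t) = g in xs[t := (xs ! t \<noteq> (\<forall>i\<in>C. xs ! i))])"

definition run_circuit :: "gate list \<Rightarrow> bool list \<Rightarrow> bool list" where
  "run_circuit c xs = fold apply_gate c xs"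

definition implements :: "nat \<Rightarrow> nat \<Rightarrow> gate list \<Rightarrow> (bool list \<Rightarrow> bool list) \<Rightarrow> bool" where
  "implements n q c f \<longleftrightarrow> (\<forall>g\<in>set c. valid_gate (n + q) g) \<and>
     (\<forall>xs. length xs = n \<longrightarrow> take n (run_circuit c (xs @ replicate q False)) = f xs)"

definition Fset :: "nat \<Rightarrow> nat \<Rightarrow> (bool list \<Rightarrow> bool list) set" where
  "Fset n q = {f. \<exists>c. implements n q c f}"

definition complexity :: "nat \<Rightarrow> nat \<Rightarrow> (bool list \<Rightarrow> bool list) \<Rightarrow> nat" where
  "complexity n q f = (LEAST k. \<exists>c. length c = k \<and> implements n q c f)"

definition shannon_L :: "nat \<Rightarrow> nat \<Rightarrow> nat" where
  "shannon_L n q = Sup (complexity n q ` Fset n q)"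

end

theory Submission
  imports Defs "HOL-Combinatorics.Permutations"
begin

text \<open>
  Upper bound.  A circuit on \<open>n + q\<close> lines induces an injection of the cube \<open>{0,1}\<^sup>n\<close> into
  \<open>{0,1}\<^sup>m\<close> with \<open>m = n + min q n\<close> (for \<open>q > n\<close> one keeps a copy of the input as garbage).  It
  extends to an even permutation moving at most \<open>2\<^sup>n\<^sup>+\<^sup>2\<close> points: for \<open>q = 0\<close> because every gate is an
  even permutation, for \<open>q > 0\<close> because the parity can be corrected outside the domain.  An even
  permutation is peeled off greedily, \<open>k\<close> disjoint transpositions at a time.  Such a block costs
  only \<open>O(m)\<close> gates when \<open>k\<close> is a power of two below a small multiple of \<open>log n\<close>: the \<open>2k\<close> moved
  vectors, written as rows of a matrix, have at most \<open>2\<^sup>2\<^sup>k\<close> distinct columns, so after clearing the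
  repeated columns with CNOTs a table lookup of negligible size moves them onto a subcube, where
  the block is one multi-controlled NOT.

  Lower bound.  All even permutations of \<open>{0,1}\<^sup>n\<close> are implementable, and there are at most
  \<open>((n + q + 1)\<^sup>3 + 1)\<^sup>L\<close> circuits of length at most \<open>L\<close>.
\<close>

section \<open>Circuits acting on sets of lines\<close>

text \<open>
  A vector is identified with the set of lines carrying a 1.  The control set of \<open>gate_act\<close> is not
  restricted in size, so \<open>gate_act (C, t)\<close> also denotes the multi-controlled NOT.
\<close>

definition gate_act :: "gate \<Rightarrow> nat set \<Rightarrow> nat set" where
  "gate_act g X = (if fst g \<subseteq> X then sym_diff X {snd g} else X)"

definition circ_act :: "gate list \<Rightarrow> nat set \<Rightarrow> nat set" where
  "circ_act c X = fold gate_act c X"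

definition valid_circuit :: "nat \<Rightarrow> gate list \<Rightarrow> bool" where
  "valid_circuit m c \<longleftrightarrow> (\<forall>g\<in>set c. valid_gate m g)"

lemma valid_gate_iff:
  "valid_gate m (C, t) \<longleftrightarrow> C \<subseteq> {..<m} \<and> t < m \<and> t \<notin> C \<and> card C \<le> 2"
  by (simp add: valid_gate_def)

lemma valid_circuit_simps [simp]:
  "valid_circuit m []"
  "valid_circuit m (g # c) \<longleftrightarrow> valid_gate m g \<and> valid_circuit m c"
  "valid_circuit m (c @ c') \<longleftrightarrow> valid_circuit m c \<and> valid_circuit m c'"
  "valid_circuit m (rev c) \<longleftrightarrow> valid_circuit m c"
  by (auto simp: valid_circuit_def)

lemma circ_act_simps [simp]:
  "circ_act [] X = X"
  "circ_act (g # c) X = circ_act c (gate_act g X)"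
  "circ_act (c @ c') X = circ_act c' (circ_act c X)"
  by (simp_all add: circ_act_def)

lemma gate_act_subset: "valid_gate m g \<Longrightarrow> X \<subseteq> {..<m} \<Longrightarrow> gate_act g X \<subseteq> {..<m}"
  by (cases g) (auto simp: gate_act_def valid_gate_iff)

lemma circ_act_subset: "valid_circuit m c \<Longrightarrow> X \<subseteq> {..<m} \<Longrightarrow> circ_act c X \<subseteq> {..<m}"
  by (induction c arbitrary: X) (auto dest: gate_act_subset)

lemma gate_act_gate_act: "snd g \<notin> fst g \<Longrightarrow> gate_act g (gate_act g X) = X"
  by (auto simp: gate_act_def)

lemma circ_act_rev: "valid_circuit m c \<Longrightarrow> circ_act (rev c) (circ_act c X) = X"
proof (induction c arbitrary: X)
  case (Cons g c)
  then have "snd g \<notin> fst g" by (cases g) (auto simp: valid_gate_iff)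
  with Cons show ?case by (simp add: gate_act_gate_act)
qed simp

lemma circ_act_rev': "valid_circuit m c \<Longrightarrow> circ_act c (circ_act (rev c) X) = X"
  using circ_act_rev[of m "rev c" X] by simp

lemma inj_circ_act: "valid_circuit m c \<Longrightarrow> inj (circ_act c)"
  by (metis circ_act_rev injI)

lemma valid_circuit_mono:
  assumes "valid_circuit m c" "m \<le> m'" shows "valid_circuit m' c"
proof -
  have "valid_gate m' g" if "valid_gate m g" for g
    using that assms(2) by (cases g) (auto simp: valid_gate_iff)
  then show ?thesis using assms(1) by (auto simp: valid_circuit_def)
qed

section \<open>Multi-controlled NOT with dirty ancillas\<close>

text \<open>
  In \<open>ladder D [(c\<^sub>1, a\<^sub>1), \<dots>] t\<close> the \<open>a\<^sub>i\<close> are dirty ancillas (Barenco et al., Lemma 7.2).  Each line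
  \<open>t, a\<^sub>1, a\<^sub>2, \<dots>\<close> is toggled iff \<open>D\<close> and all later controls are set; running the ladder for \<open>a\<^sub>1\<close>
  once more restores the ancillas.
\<close>

fun ladder :: "nat set \<Rightarrow> (nat \<times> nat) list \<Rightarrow> nat \<Rightarrow> gate list" where
  "ladder D [] t = [(D, t)]"
| "ladder D ((c, a) # ps) t = ({c, a}, t) # ladder D ps a @ [({c, a}, t)]"

fun ladder_flips :: "nat set \<Rightarrow> (nat \<times> nat) list \<Rightarrow> nat \<Rightarrow> nat set \<Rightarrow> nat set" where
  "ladder_flips D [] t X = (if D \<subseteq> X then {t} else {})"
| "ladder_flips D ((c, a) # ps) t X =
    (if D \<union> insert c (fst ` set ps) \<subseteq> X then {t} else {}) \<union> ladder_flips D ps a X"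

lemma length_ladder: "length (ladder D ps t) = 2 * length ps + 1"
  by (induction D ps t rule: ladder.induct) auto

lemma ladder_flips_subset: "ladder_flips D ps t X \<subseteq> insert t (snd ` set ps)"
  by (induction D ps t X rule: ladder_flips.induct) auto

lemma target_in_ladder_flips:
  "t \<notin> snd ` set ps \<Longrightarrow> t \<in> ladder_flips D ps t X \<longleftrightarrow> D \<union> fst ` set ps \<subseteq> X"
proof (cases ps)
  case (Cons p ps')
  obtain c a where p: "p = (c, a)" by (cases p)
  assume "t \<notin> snd ` set ps"
  then show ?thesis using ladder_flips_subset[of D ps' a X] Cons p by auto
qed auto

text \<open>Applied to inputs that differ only in toggled lines: the flips may be evaluated on the
  original input although earlier gates have changed \<open>t\<close> or the ancillas.\<close>

lemma ladder_flips_cong: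
  "X \<inter> (D \<union> fst ` set ps) = Y \<inter> (D \<union> fst ` set ps) \<Longrightarrow> ladder_flips D ps t X = ladder_flips D ps t Y"
proof (induction ps arbitrary: t)
  case Nil
  then have "D \<subseteq> X \<longleftrightarrow> D \<subseteq> Y" by auto
  then show ?case by simp
next
  case (Cons p ps)
  obtain c a where p: "p = (c, a)" by (cases p)
  have "D \<union> insert c (fst ` set ps) \<subseteq> X \<longleftrightarrow> D \<union> insert c (fst ` set ps) \<subseteq> Y"
  proof -
    have "Z \<subseteq> X \<longleftrightarrow> Z \<subseteq> Y" if "X \<inter> Z = Y \<inter> Z" for Z using that by blast
    from this[of "D \<union> insert c (fst ` set ps)"] show ?thesis using Cons.prems p by simp
  qed
  moreover have "ladder_flips D ps a X = ladder_flips D ps a Y"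
    by (rule Cons.IH) (use Cons.prems p in auto)
  ultimately show ?case by (simp add: p)
qed

text \<open>The two outer gates see \<open>a\<close> before and after the inner ladder, so
  \<open>t\<close> changes exactly when \<open>c\<close> is set and the inner ladder toggles
  \<open>a\<close>; the dirty initial value of \<open>a\<close> cancels.\<close>

lemma circ_act_ladder:
  assumes "distinct (t # map snd ps)" "insert t (snd ` set ps) \<inter> (D \<union> fst ` set ps) = {}"
  shows "circ_act (ladder D ps t) X = sym_diff X (ladder_flips D ps t X)"
  using assms
proof (induction ps arbitrary: t X)
  case Nil
  then show ?case by (auto simp: gate_act_def)
next
  case (Cons p ps)
  obtain c a where p: "p = (c, a)" by (cases p)
  define X1 where "X1 = gate_act ({c, a}, t) X"
  define X2 where "X2 = circ_act (ladder D ps a) X1"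
  have X1: "X1 = (if c \<in> X \<and> a \<in> X then sym_diff X {t} else X)"
    by (auto simp: X1_def gate_act_def)
  have "ladder_flips D ps a X1 = ladder_flips D ps a X"
    by (rule ladder_flips_cong) (use Cons.prems p in \<open>auto simp: X1\<close>)
  then have X2: "X2 = sym_diff X1 (ladder_flips D ps a X)"
    unfolding X2_def by (subst Cons.IH) (use Cons.prems p in auto)
  have a: "a \<in> ladder_flips D ps a X \<longleftrightarrow> D \<union> fst ` set ps \<subseteq> X"
    by (rule target_in_ladder_flips) (use Cons.prems p in auto)
  have t: "t \<notin> ladder_flips D ps a X" "c \<notin> ladder_flips D ps a X" "c \<noteq> t" "a \<noteq> t"
    using ladder_flips_subset[of D ps a X] Cons.prems p by auto
  have cX2: "c \<in> X2 \<longleftrightarrow> c \<in> X" using t by (auto simp: X1 X2)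
  have aX2: "a \<in> X2 \<longleftrightarrow> (a \<in> X) \<noteq> (D \<union> fst ` set ps \<subseteq> X)" using t a by (auto simp: X1 X2)
  have eq: "circ_act (ladder D (p # ps) t) X = gate_act ({c, a}, t) X2"
    by (simp add: p X1_def X2_def)
  \<comment> \<open>Membership is expressed by exclusive or, which turns the set equation into a
    propositional identity for each line.\<close>
  have m1: "i \<in> gate_act ({c, a}, t) X2 \<longleftrightarrow> (i \<in> X2) \<noteq> (i = t \<and> c \<in> X2 \<and> a \<in> X2)" for i
    by (auto simp: gate_act_def)
  have m2: "i \<in> X2 \<longleftrightarrow> ((i \<in> X) \<noteq> (i = t \<and> c \<in> X \<and> a \<in> X)) \<noteq> (i \<in> ladder_flips D ps a X)" for i
    by (auto simp: X1 X2)
  have m3: "i \<in> ladder_flips D (p # ps) t X \<longleftrightarrow>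
      (i = t \<and> c \<in> X \<and> D \<union> fst ` set ps \<subseteq> X) \<or> i \<in> ladder_flips D ps a X" for i
    by (auto simp: p)
  have m4: "i \<in> sym_diff X Y \<longleftrightarrow> (i \<in> X) \<noteq> (i \<in> Y)" for i Y by auto
  show ?case unfolding eq
  proof (rule set_eqI)
    fix i
    show "i \<in> gate_act ({c, a}, t) X2 \<longleftrightarrow> i \<in> sym_diff X (ladder_flips D (p # ps) t X)"
      unfolding m1 cX2 aX2 unfolding m4 m2 m3 using t(1)
      by (cases "i = t"; cases "c \<in> X"; cases "a \<in> X"; cases "t \<in> X") simp_all
  qed
qed

text \<open>For three or more controls, \<open>D\<close> takes two of them and each of the other
  \<open>card C - 2\<close> is paired with a line of \<open>A\<close>, whence the bound on
  \<open>card A\<close>. The first ladder toggles \<open>t\<close> correctly but disturbs ancillas;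
  the second, started at \<open>a\<close>, undoes exactly this disturbance.\<close>

lemma exists_mcx_many_dirty:
  assumes fin: "C \<union> A \<subseteq> {..<m}" and tm: "t < m" and tC: "t \<notin> C" "t \<notin> A"
    and CA: "A \<inter> C = {}" and card: "card C \<le> card A + 2"
  shows "\<exists>c. valid_circuit m c \<and> length c \<le> 4 * card C + 1 \<and> circ_act c = gate_act (C, t)"
proof (cases "card C \<le> 2")
  case True
  have "valid_circuit m [(C, t)]" using True assms by (auto simp: valid_gate_iff)
  then show ?thesis by (intro exI[of _ "[(C, t)]"]) (auto simp: fun_eq_iff)
next
  case False
  have finC: "finite C" and finA: "finite A" using fin finite_subset by blast+
  obtain D where D: "D \<subseteq> C" "card D = 2" "finite D"
    using False obtain_subset_with_card_n[of 2 C] by (metis finC finite_subset nat_le_linear)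
  have cD: "card (C - D) = card C - 2" using D by (simp add: card_Diff_subset)
  obtain A' where A': "A' \<subseteq> A" "card A' = card C - 2" "finite A'"
    using card obtain_subset_with_card_n[of "card C - 2" A] by (metis finA finite_subset le_diff_conv)
  obtain cs where cs: "set cs = C - D" "distinct cs"
    using finite_distinct_list finC by (metis finite_Diff)
  obtain as where as: "set as = A'" "distinct as" using finite_distinct_list A' by metis
  have len: "length cs = card C - 2" "length as = card C - 2"
    using cs as cD A' distinct_card by metis+
  obtain c cs' where c: "cs = c # cs'" using len False by (cases cs) auto
  obtain a as' where a: "as = a # as'" using len False by (cases as) auto
  define ps where "ps = zip cs' as'"
  have len': "length cs' = length as'" using len c a by simp
  have fs: "fst ` set ps = set cs'" and ss: "snd ` set ps = set as'" "map snd ps = as'"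
    using len' by (auto simp: ps_def simp flip: set_map)
  have lps: "length ps = card C - 3" using len c a len' by (simp add: ps_def)
  have d1: "distinct (t # map snd ((c, a) # ps))" "distinct (a # map snd ps)"
    using as a A' tC by (auto simp: ss)
  have sets: "set cs' \<subseteq> C" "c \<in> C" "a \<in> A" "set as' \<subseteq> A" "D \<union> insert c (set cs') = C"
    using cs c as a A' D by auto
  have e1: "circ_act (ladder D ((c, a) # ps) t) X = sym_diff X (ladder_flips D ((c, a) # ps) t X)" for X
    by (rule circ_act_ladder[OF d1(1)]) (use sets CA tC D in \<open>auto simp: fs ss\<close>)
  have e2: "circ_act (ladder D ps a) X = sym_diff X (ladder_flips D ps a X)" for X
    by (rule circ_act_ladder[OF d1(2)]) (use sets CA tC D in \<open>auto simp: fs ss\<close>)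
  have flC: "ladder_flips D ps a X \<subseteq> A" for X
    using ladder_flips_subset[of D ps a X] sets ss by auto
  have main: "circ_act (ladder D ((c, a) # ps) t @ ladder D ps a) X = gate_act (C, t) X" for X
  proof -
    define Y where "Y = sym_diff X (ladder_flips D ((c, a) # ps) t X)"
    have fl: "ladder_flips D ((c, a) # ps) t X = (if C \<subseteq> X then {t} else {}) \<union> ladder_flips D ps a X"
      using sets by (simp add: fs)
    \<comment> \<open>Passing from \<open>X\<close> to \<open>Y\<close> changes only
      \<open>t\<close> and lines of \<open>A\<close>, none of which belongs to
      \<open>C\<close>.\<close>
    have "ladder_flips D ps a Y = ladder_flips D ps a X"
      by (rule ladder_flips_cong)
        (use sets CA tC D flC[of X] in \<open>auto simp: Y_def fl fs simp del: ladder_flips.simps split: if_splits\<close>)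
    then have "circ_act (ladder D ((c, a) # ps) t @ ladder D ps a) X = sym_diff Y (ladder_flips D ps a X)"
      by (simp only: circ_act_simps(3) e1 e2 Y_def)
    also have "\<dots> = gate_act (C, t) X"
      using flC[of X] tC by (auto simp: Y_def fl gate_act_def simp del: ladder_flips.simps)
    finally show ?thesis .
  qed
  have val: "valid_circuit m (ladder D qs s)"
    if "fst ` set qs \<subseteq> C" "snd ` set qs \<subseteq> A" "s < m" "s \<notin> C" "distinct (s # map snd qs)" for qs s
    using that
  proof (induction qs arbitrary: s)
    case Nil
    then show ?case using D fin by (auto simp: valid_gate_iff)
  next
    case (Cons q qs)
    obtain x y where q: "q = (x, y)" by (cases q)
    have "valid_circuit m (ladder D qs y)"
      by (rule Cons.IH) (use Cons.prems q fin CA in auto)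
    moreover have "valid_gate m ({x, y}, s)"
      using Cons.prems q fin by (auto simp: valid_gate_iff card_insert_if)
    ultimately show ?case by (simp add: q)
  qed
  have "valid_circuit m (ladder D ((c, a) # ps) t)"
    by (rule val[OF _ _ _ _ d1(1)]) (use sets fs ss tm tC in auto)
  moreover have "valid_circuit m (ladder D ps a)"
  proof (rule val[OF _ _ _ _ d1(2)])
    show "fst ` set ps \<subseteq> C" "snd ` set ps \<subseteq> A" using sets fs ss by simp_all
    show "a < m" "a \<notin> C" using sets(3) fin CA by auto
  qed
  moreover have "length (ladder D ((c, a) # ps) t @ ladder D ps a) \<le> 4 * card C + 1"
    using lps False by (simp add: length_ladder)
  ultimately show ?thesis
    by (intro exI[of _ "ladder D ((c, a) # ps) t @ ladder D ps a"]) (use main in \<open>auto simp del: circ_act_simps\<close>)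
qed

lemma exists_mcx:
  assumes C: "C \<subseteq> {..<m}" and t: "t < m" "t \<notin> C" and d: "d < m" "d \<notin> C" "d \<noteq> t"
  shows "\<exists>c. valid_circuit m c \<and> length c \<le> 8 * card C + 12 \<and> circ_act c = gate_act (C, t)"
proof -
  have fin: "finite C" using C finite_subset by blast
  \<comment> \<open>Commutator trick: each half of \<open>C\<close> provides the dirty ancillas for the gate controlled by the other.\<close>
  obtain C1 where C1: "C1 \<subseteq> C" "card C1 = card C div 2" "finite C1"
    by (metis obtain_subset_with_card_n div_le_dividend fin finite_subset)
  define C2 where "C2 = C - C1"
  have c2: "card C2 = card C - card C div 2" using C1 by (simp add: C2_def card_Diff_subset)
  have fin2: "finite C2" using fin by (simp add: C2_def)
  have dC2: "d \<notin> C2" "t \<notin> C2" using d t by (auto simp: C2_def)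
  have "\<exists>c. valid_circuit m c \<and> length c \<le> 4 * card C1 + 1 \<and> circ_act c = gate_act (C1, d)"
  proof (rule exists_mcx_many_dirty)
    show "C1 \<union> insert t C2 \<subseteq> {..<m}" using C C1 t by (auto simp: C2_def)
    show "card C1 \<le> card (insert t C2) + 2" using fin2 dC2 c2 C1 by simp
  qed (use C1 t d dC2 in \<open>auto simp: C2_def\<close>)
  then obtain c1 where c1: "valid_circuit m c1" "length c1 \<le> 4 * card C1 + 1"
      "circ_act c1 = gate_act (C1, d)" by blast
  have k2: "card (insert d C2) = card C2 + 1" using fin2 dC2 by simp
  have "\<exists>c. valid_circuit m c \<and> length c \<le> 4 * card (insert d C2) + 1 \<and>
      circ_act c = gate_act (insert d C2, t)"
  proof (rule exists_mcx_many_dirty)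
    show "insert d C2 \<union> C1 \<subseteq> {..<m}" using C C1 d by (auto simp: C2_def)
    show "card (insert d C2) \<le> card C1 + 2" using k2 c2 C1 by simp
  qed (use C1 t d dC2 in \<open>auto simp: C2_def\<close>)
  then obtain c2 where c2': "valid_circuit m c2" "length c2 \<le> 4 * card (insert d C2) + 1"
      "circ_act c2 = gate_act (insert d C2, t)" by blast
  have CC: "C \<subseteq> X \<longleftrightarrow> C1 \<subseteq> X \<and> C2 \<subseteq> X" for X using C1 by (auto simp: C2_def)
  have dt: "d \<notin> C1" "t \<notin> C1" using d t C1 by auto
  have s1: "C1 \<subseteq> gate_act (D, s) X \<longleftrightarrow> C1 \<subseteq> X" if "s = d \<or> s = t" for D s X
    using dt that by (auto simp: gate_act_def)
  have s2: "C2 \<subseteq> gate_act (D, s) X \<longleftrightarrow> C2 \<subseteq> X" if "s = d \<or> s = t" for D s X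
    using dC2 that by (auto simp: gate_act_def)
  \<comment> \<open>The first \<open>c2\<close> adds to \<open>t\<close> the value of
    \<open>d\<close> toggled by \<open>C1\<close>, the second adds the restored \<open>d\<close>,
    both masked by \<open>C2\<close>. The two contributions sum to the conjunction of
    \<open>C1\<close> and \<open>C2\<close>.\<close>
  have main: "circ_act (c1 @ c2 @ c1 @ c2) X = gate_act (C, t) X" for X
  proof -
    define X1 where "X1 = gate_act (C1, d) X"
    define X2 where "X2 = gate_act (insert d C2, t) X1"
    define X3 where "X3 = gate_act (C1, d) X2"
    define X4 where "X4 = gate_act (insert d C2, t) X3"
    have m1: "i \<in> X1 \<longleftrightarrow> (i \<in> X) \<noteq> (i = d \<and> C1 \<subseteq> X)" for i
      by (auto simp: X1_def gate_act_def)
    have a1: "C1 \<subseteq> X1 \<longleftrightarrow> C1 \<subseteq> X" "C2 \<subseteq> X1 \<longleftrightarrow> C2 \<subseteq> X" by (auto simp: X1_def s1 s2)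
    have m2: "i \<in> X2 \<longleftrightarrow> (i \<in> X1) \<noteq> (i = t \<and> d \<in> X1 \<and> C2 \<subseteq> X)" for i
      by (auto simp: X2_def gate_act_def a1)
    have a2: "C1 \<subseteq> X2 \<longleftrightarrow> C1 \<subseteq> X" "C2 \<subseteq> X2 \<longleftrightarrow> C2 \<subseteq> X" by (auto simp: X2_def s1 s2 a1)
    have m3: "i \<in> X3 \<longleftrightarrow> (i \<in> X2) \<noteq> (i = d \<and> C1 \<subseteq> X)" for i
      by (auto simp: X3_def gate_act_def a2)
    have a3: "C2 \<subseteq> X3 \<longleftrightarrow> C2 \<subseteq> X" by (auto simp: X3_def s2 a2)
    have m4: "i \<in> X4 \<longleftrightarrow> (i \<in> X3) \<noteq> (i = t \<and> d \<in> X3 \<and> C2 \<subseteq> X)" for i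
      by (auto simp: X4_def gate_act_def a3)
    have m5: "i \<in> gate_act (C, t) X \<longleftrightarrow> (i \<in> X) \<noteq> (i = t \<and> C1 \<subseteq> X \<and> C2 \<subseteq> X)" for i
      by (auto simp: gate_act_def CC)
    have "X4 = gate_act (C, t) X"
      unfolding set_eq_iff m5 m4 m3 m2 m1 using d by blast
    then show ?thesis by (simp add: c1 c2' X1_def X2_def X3_def X4_def)
  qed
  have "length (c1 @ c2 @ c1 @ c2) \<le> 8 * card C + 12"
    using c1(2) c2'(2) k2 c2 C1(2) by simp
  moreover have "valid_circuit m (c1 @ c2 @ c1 @ c2)" using c1(1) c2'(1) by simp
  moreover have "circ_act (c1 @ c2 @ c1 @ c2) = gate_act (C, t)" using main by blast
  ultimately show ?thesis by blast
qed

section \<open>Blocks of disjoint transpositions\<close>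

text \<open>Since \<open>P t\<close> ignores all lines of \<open>T\<close>, toggling some targets
  does not affect the conditions of the others, and the individual circuits can simply be
  concatenated.\<close>

lemma exists_flip_family:
  assumes "finite T" "\<And>t. t \<in> T \<Longrightarrow> \<exists>c. valid_circuit m c \<and> length c \<le> L \<and>
      (\<forall>X. circ_act c X = (if P t X then sym_diff X {t} else X))"
    and P: "\<And>t X Y. t \<in> T \<Longrightarrow> X - T = Y - T \<Longrightarrow> P t X = P t Y"
  shows "\<exists>c. valid_circuit m c \<and> length c \<le> card T * L \<and>
      (\<forall>X. circ_act c X = sym_diff X {t\<in>T. P t X})"
proof -
  have "\<exists>c. valid_circuit m c \<and> length c \<le> card S * L \<and>
      (\<forall>X. circ_act c X = sym_diff X {t\<in>S. P t X})" if "S \<subseteq> T" for S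
    using finite_subset[OF that assms(1)] that
  proof (induction S rule: finite_induct)
    case empty
    show ?case by (rule exI[of _ "[]"]) simp
  next
    case (insert s S)
    then obtain c where c: "valid_circuit m c" "length c \<le> card S * L"
      "\<And>X. circ_act c X = sym_diff X {t\<in>S. P t X}" by auto
    obtain c' where c': "valid_circuit m c'" "length c' \<le> L"
      "\<And>X. circ_act c' X = (if P s X then sym_diff X {s} else X)"
      using assms(2)[of s] insert.prems by auto
    have "circ_act (c @ c') X = sym_diff X {t\<in>insert s S. P t X}" for X
    proof -
      have "P s (sym_diff X {t\<in>S. P t X}) = P s X"
        by (rule P) (use insert.prems in auto)
      then show ?thesis using insert.hyps by (auto simp: c c')
    qed
    moreover have "length (c @ c') \<le> card (insert s S) * L"
      using c(2) c'(2) insert.hyps by simp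
    ultimately show ?case using c(1) c'(1) by (intro exI[of _ "c @ c'"]) (simp del: circ_act_simps)
  qed
  then show ?thesis by simp
qed

lemma exists_not_circuit:
  assumes "S \<subseteq> {..<m}"
  shows "\<exists>c. valid_circuit m c \<and> length c \<le> card S \<and> (\<forall>X. circ_act c X = sym_diff X S)"
proof -
  have "\<exists>c. valid_circuit m c \<and> length c \<le> card S * 1 \<and>
      (\<forall>X. circ_act c X = sym_diff X {t\<in>S. True})"
  proof (rule exists_flip_family)
    fix t assume "t \<in> S"
    then show "\<exists>c. valid_circuit m c \<and> length c \<le> 1 \<and> (\<forall>X. circ_act c X = (if True then sym_diff X {t} else X))"
      using assms by (intro exI[of _ "[({}, t)]"]) (auto simp: valid_gate_iff gate_act_def)
  qed (use assms finite_subset in auto)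
  then show ?thesis by simp
qed

text \<open>Conjugation by NOTs on \<open>R - P\<close> turns the test for the pattern
  \<open>P\<close> into the test that all lines of \<open>R\<close> are set. The two layers of NOTs
  raise the factor from 8 to 10.\<close>

lemma exists_pattern_circuit:
  assumes R: "R \<subseteq> {..<m}" "P \<subseteq> R" and t: "t < m" "t \<notin> R" and d: "d < m" "d \<notin> R" "d \<noteq> t"
  shows "\<exists>c. valid_circuit m c \<and> length c \<le> 10 * card R + 12 \<and>
      (\<forall>X. circ_act c X = (if X \<inter> R = P then sym_diff X {t} else X))"
proof -
  have RP: "R - P \<subseteq> {..<m}" and fin: "finite R" using R finite_subset by auto
  obtain c1 where c1: "valid_circuit m c1" "length c1 \<le> card (R - P)"
    "\<And>X. circ_act c1 X = sym_diff X (R - P)" using exists_not_circuit[OF RP] by auto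
  obtain c2 where c2: "valid_circuit m c2" "length c2 \<le> 8 * card R + 12" "circ_act c2 = gate_act (R, t)"
    using exists_mcx[OF R(1) t d] by auto
  have card: "card (R - P) \<le> card R" using fin by (simp add: card_mono)
  have "circ_act (c1 @ c2 @ c1) X = (if X \<inter> R = P then sym_diff X {t} else X)" for X
  proof -
    have "R \<subseteq> sym_diff X (R - P) \<longleftrightarrow> X \<inter> R = P" using R by blast
    moreover have "sym_diff (sym_diff (sym_diff X (R - P)) {t}) (R - P) = sym_diff X {t}"
      using t by auto
    moreover have "sym_diff (sym_diff X (R - P)) (R - P) = X" by auto
    ultimately show ?thesis by (simp add: c1 c2 gate_act_def)
  qed
  then show ?thesis using c1 c2 card by (intro exI[of _ "c1 @ c2 @ c1"]) (simp del: circ_act_simps)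
qed

text \<open>At most one pattern matches, and toggling \<open>t\<close> outside \<open>R\<close> does
  not change which one; so the concatenated pattern circuits toggle \<open>t\<close> at most
  once.\<close>

lemma exists_patterns_circuit:
  assumes R: "R \<subseteq> {..<m}" "\<P> \<subseteq> Pow R" and t: "t < m" "t \<notin> R" and d: "d < m" "d \<notin> R" "d \<noteq> t"
  shows "\<exists>c. valid_circuit m c \<and> length c \<le> card \<P> * (10 * card R + 12) \<and>
      (\<forall>X. circ_act c X = (if X \<inter> R \<in> \<P> then sym_diff X {t} else X))"
proof -
  have "finite \<P>" using R by (meson finite_Pow_iff finite_lessThan finite_subset)
  then show ?thesis using R(2)
  proof (induction \<P> rule: finite_induct)
    case empty
    show ?case by (rule exI[of _ "[]"]) simp
  next
    case (insert P \<P>)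
    then obtain c where c: "valid_circuit m c" "length c \<le> card \<P> * (10 * card R + 12)"
      "\<And>X. circ_act c X = (if X \<inter> R \<in> \<P> then sym_diff X {t} else X)" by auto
    obtain c' where c': "valid_circuit m c'" "length c' \<le> 10 * card R + 12"
      "\<And>X. circ_act c' X = (if X \<inter> R = P then sym_diff X {t} else X)"
      using exists_pattern_circuit[OF R(1) _ t d, of P] insert.prems by auto
    have "circ_act (c @ c') X = (if X \<inter> R \<in> insert P \<P> then sym_diff X {t} else X)" for X
    proof -
      have "sym_diff X {t} \<inter> R = X \<inter> R" using t by auto
      then show ?thesis using insert.hyps by (auto simp: c c')
    qed
    then show ?case using c c' insert.hyps
      by (intro exI[of _ "c @ c'"]) (simp del: circ_act_simps)
  qed
qed

text \<open>A table lookup, one target line at a time: \<open>t\<close> is toggled for those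
  patterns whose entry contains it. All targets share the idle line \<open>d\<close>.\<close>

lemma exists_lookup_circuit:
  assumes R: "R \<subseteq> {..<m}" "\<P> \<subseteq> Pow R" and T: "T \<subseteq> {..<m}" "T \<inter> R = {}"
    and d: "d < m" "d \<notin> R" "d \<notin> T"
  shows "\<exists>c. valid_circuit m c \<and> length c \<le> card T * (card \<P> * (10 * card R + 12)) \<and>
      (\<forall>X. X \<inter> R \<in> \<P> \<longrightarrow> circ_act c X = sym_diff X (h (X \<inter> R) \<inter> T))"
proof -
  have finP: "finite \<P>" using R by (meson finite_Pow_iff finite_lessThan finite_subset)
  have "\<exists>c. valid_circuit m c \<and> length c \<le> card T * (card \<P> * (10 * card R + 12)) \<and>
      (\<forall>X. circ_act c X = sym_diff X {t\<in>T. X \<inter> R \<in> {p\<in>\<P>. t \<in> h p}})"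
  proof (rule exists_flip_family)
    show "finite T" using T finite_subset by blast
    fix t assume "t \<in> T"
    then have "\<exists>c. valid_circuit m c \<and> length c \<le> card {p\<in>\<P>. t \<in> h p} * (10 * card R + 12) \<and>
      (\<forall>X. circ_act c X = (if X \<inter> R \<in> {p\<in>\<P>. t \<in> h p} then sym_diff X {t} else X))"
      by (intro exists_patterns_circuit[of _ _ _ _ d]) (use R T d in auto)
    moreover have "card {p\<in>\<P>. t \<in> h p} * (10 * card R + 12) \<le> card \<P> * (10 * card R + 12)"
      by (intro mult_right_mono card_mono finP) auto
    ultimately show "\<exists>c. valid_circuit m c \<and> length c \<le> card \<P> * (10 * card R + 12) \<and>
      (\<forall>X. circ_act c X = (if X \<inter> R \<in> {p\<in>\<P>. t \<in> h p} then sym_diff X {t} else X))"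
      using order_trans by blast
  next
    fix t X Y assume "X - T = Y - T"
    then have "X \<inter> R = Y \<inter> R" using T by auto
    then show "(X \<inter> R \<in> {p\<in>\<P>. t \<in> h p}) = (Y \<inter> R \<in> {p\<in>\<P>. t \<in> h p})" by simp
  qed
  moreover have "{t\<in>T. X \<inter> R \<in> {p\<in>\<P>. t \<in> h p}} = h (X \<inter> R) \<inter> T" if "X \<inter> R \<in> \<P>" for X
    using that by auto
  ultimately show ?thesis by auto
qed

section \<open>Encoding a few vectors by a subcube\<close>

text \<open>With the vectors of \<open>\<V>\<close> as rows of a matrix, \<open>col l\<close> is its
  column \<open>l\<close>. One line for each distinct column is kept in \<open>R\<close>; a CNOT
  from the representative \<open>rep t\<close> clears any other line \<open>t\<close> on all of
  \<open>\<V>\<close> at once.\<close>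

lemma exists_dedupe_circuit:
  assumes "finite \<V>"
  shows "\<exists>R c. R \<subseteq> {..<m} \<and> card R \<le> 2 ^ card \<V> \<and> valid_circuit m c \<and> length c \<le> m \<and>
      (\<forall>v\<in>\<V>. v \<subseteq> {..<m} \<longrightarrow> circ_act c v = v \<inter> R)"
proof -
  define col where "col l = {v\<in>\<V>. l \<in> v}" for l :: nat
  define rep where "rep l = inv_into {..<m} col (col l)" for l
  define R where "R = rep ` {..<m}"
  have rep: "rep l < m" "col (rep l) = col l" if "l < m" for l
    using that inv_into_into[of "col l" col "{..<m}"] f_inv_into_f[of "col l" col "{..<m}"]
    by (auto simp: rep_def)
  have Rm: "R \<subseteq> {..<m}" using rep by (auto simp: R_def)
  have "R = inv_into {..<m} col ` col ` {..<m}" by (auto simp: R_def rep_def)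
  then have "card R \<le> card (col ` {..<m})" by (simp add: card_image_le)
  also have "\<dots> \<le> card (Pow \<V>)" by (intro card_mono) (use assms in \<open>auto simp: col_def\<close>)
  finally have cR: "card R \<le> 2 ^ card \<V>" using assms by (simp add: card_Pow)
  define T where "T = {..<m} - R"
  have "\<exists>c. valid_circuit m c \<and> length c \<le> card T * 1 \<and>
      (\<forall>X. circ_act c X = sym_diff X {t\<in>T. rep t \<in> X})"
  proof (rule exists_flip_family)
    fix t assume "t \<in> T"
    then have "t < m" "t \<notin> R" by (auto simp: T_def)
    moreover have "rep t \<in> R" using \<open>t < m\<close> by (auto simp: R_def)
    ultimately have "t < m" "rep t \<noteq> t" by auto
    then show "\<exists>c. valid_circuit m c \<and> length c \<le> 1 \<and>
        (\<forall>X. circ_act c X = (if rep t \<in> X then sym_diff X {t} else X))"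
      using rep(1)[of t] by (intro exI[of _ "[({rep t}, t)]"]) (auto simp: valid_gate_iff gate_act_def)
  next
    fix t X Y assume "t \<in> T" "X - T = Y - T"
    moreover have "rep t \<notin> T" using \<open>t \<in> T\<close> by (auto simp: T_def R_def)
    ultimately show "(rep t \<in> X) = (rep t \<in> Y)" by auto
  qed (auto simp: T_def)
  then obtain c where c: "valid_circuit m c" "length c \<le> card T"
    "\<And>X. circ_act c X = sym_diff X {t\<in>T. rep t \<in> X}" by auto
  have "card T \<le> m" unfolding T_def using card_mono[of "{..<m}" "{..<m} - R"] by simp
  moreover have "circ_act c v = v \<inter> R" if "v \<in> \<V>" "v \<subseteq> {..<m}" for v
  proof -
    have "rep t \<in> v \<longleftrightarrow> t \<in> v" if "t \<in> T" for t
      using rep(2)[of t] that \<open>v \<in> \<V>\<close> by (auto simp: col_def T_def)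
    then have "{t\<in>T. rep t \<in> v} = v \<inter> T" by auto
    then show ?thesis using that by (auto simp: c T_def)
  qed
  ultimately show ?thesis using c Rm cR by (intro exI[of _ R] exI[of _ c]) auto
qed

text \<open>Three stages send \<open>v\<close> to \<open>v \<inter> R\<close>, then to
  \<open>(v \<inter> R) \<union> \<beta> v\<close> by a lookup on \<open>R\<close>, then to
  \<open>\<beta> v\<close> by a lookup on \<open>T\<close> that erases the old content.
  \<open>T\<close> is fixed before \<open>\<beta>\<close> so that a caller can choose an encoding
  with range \<open>Pow T\<close>.\<close>

lemma exists_encoding_circuit:
  assumes V: "\<V> \<subseteq> Pow {..<m}" "card \<V> = 2 ^ s" and s: "s \<ge> 2" and m: "(2 ^ 2 ^ s) ^ 3 \<le> m"
  shows "\<exists>T\<subseteq>{..<m}. card T = s \<and> (\<forall>\<beta>. bij_betw \<beta> \<V> (Pow T) \<longrightarrow>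
      (\<exists>c. valid_circuit m c \<and> length c \<le> 45 * m \<and> (\<forall>v\<in>\<V>. circ_act c v = \<beta> v)))"
proof -
  define K :: nat where "K = 2 ^ s"
  define M :: nat where "M = 2 ^ K"
  have finV: "finite \<V>" using V by (metis card.infinite power_not_zero zero_neq_numeral)
  from exists_dedupe_circuit[OF finV, of m] obtain R c1 where
    "R \<subseteq> {..<m}" "card R \<le> 2 ^ card \<V>" "valid_circuit m c1" "length c1 \<le> m"
    and c1_act: "\<forall>v\<in>\<V>. v \<subseteq> {..<m} \<longrightarrow> circ_act c1 v = v \<inter> R" by blast
  moreover have "circ_act c1 v = v \<inter> R" if "v \<in> \<V>" for v using c1_act V(1) that by blast
  ultimately have c1: "R \<subseteq> {..<m}" "card R \<le> M" "valid_circuit m c1" "length c1 \<le> m"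
    "\<And>v. v \<in> \<V> \<Longrightarrow> circ_act c1 v = v \<inter> R"
    by (simp_all add: M_def K_def V(2))
  have sK: "s < K" and KM: "K < M" by (simp_all add: K_def M_def)
  \<comment> \<open>Up to the factor 22, this product bounds the cost of either lookup.\<close>
  have M3: "M * K\<^sup>2 \<le> m"
  proof -
    have "M * K\<^sup>2 \<le> M * M\<^sup>2" using KM by (intro mult_left_mono power_mono) auto
    also have "\<dots> = M ^ 3" by (simp add: power2_eq_square power3_eq_cube)
    finally show ?thesis using m by (simp add: M_def K_def)
  qed
  have "4 \<le> K" using s power_increasing[of 2 s "2::nat"] by (simp add: K_def)
  then have "M * 16 \<le> M * K\<^sup>2" using power_mono[of 4 K 2] by (intro mult_left_mono) auto
  then have "M + s + 1 \<le> m" using M3 sK KM by linarith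
  have finR: "finite R" using c1 finite_subset by blast
  \<comment> \<open>Room outside \<open>R\<close> for the \<open>s\<close> lines of \<open>T\<close>
    and one idle line \<open>d\<close>.\<close>
  have "s + 1 \<le> card ({..<m} - R)"
    using card_Diff_subset[OF finR c1(1)] c1(2) \<open>M + s + 1 \<le> m\<close> by simp
  then obtain T' where T': "T' \<subseteq> {..<m} - R" "card T' = s + 1" "finite T'"
    using obtain_subset_with_card_n by (metis finite_Diff finite_lessThan finite_subset)
  then obtain d where d: "d \<in> T'" by fastforce
  define T where "T = T' - {d}"
  have T: "T \<subseteq> {..<m}" "T \<inter> R = {}" "card T = s" "d < m" "d \<notin> R" "d \<notin> T" "finite T"
    using T' d by (auto simp: T_def)
  have inj: "inj_on (\<lambda>v. v \<inter> R) \<V>"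
  proof (rule inj_onI)
    fix v w assume "v \<in> \<V>" "w \<in> \<V>" "v \<inter> R = w \<inter> R"
    then have "circ_act c1 v = circ_act c1 w" by (simp add: c1(5))
    then show "v = w" using inj_circ_act[OF c1(3)] by (simp add: inj_eq)
  qed
  have "\<exists>c. valid_circuit m c \<and> length c \<le> 45 * m \<and> (\<forall>v\<in>\<V>. circ_act c v = \<beta> v)"
    if \<beta>: "bij_betw \<beta> \<V> (Pow T)" for \<beta>
  proof -
    define \<P> where "\<P> = (\<lambda>v. v \<inter> R) ` \<V>"
    define h2 where "h2 p = \<beta> (inv_into \<V> (\<lambda>v. v \<inter> R) p)" for p
    define h3 where "h3 p = inv_into \<V> \<beta> p" for p
    have cP: "card \<P> = K" using card_image[OF inj] V by (simp add: \<P>_def K_def)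
    have "\<exists>c. valid_circuit m c \<and> length c \<le> card T * (card \<P> * (10 * card R + 12)) \<and>
      (\<forall>X. X \<inter> R \<in> \<P> \<longrightarrow> circ_act c X = sym_diff X (h2 (X \<inter> R) \<inter> T))"
      by (rule exists_lookup_circuit[where d = d]) (use T c1(1) in \<open>auto simp: \<P>_def\<close>)
    then obtain c2 where c2: "valid_circuit m c2" "length c2 \<le> s * (K * (10 * card R + 12))"
      "\<And>X. X \<inter> R \<in> \<P> \<Longrightarrow> circ_act c2 X = sym_diff X (h2 (X \<inter> R) \<inter> T)"
      using T cP by auto
    have "\<exists>c. valid_circuit m c \<and> length c \<le> card R * (card (Pow T) * (10 * card T + 12)) \<and>
      (\<forall>X. X \<inter> T \<in> Pow T \<longrightarrow> circ_act c X = sym_diff X (h3 (X \<inter> T) \<inter> R))"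
      by (rule exists_lookup_circuit[where d = d]) (use T c1(1) in auto)
    then obtain c3 where c3: "valid_circuit m c3" "length c3 \<le> card R * (K * (10 * s + 12))"
      "\<And>X. circ_act c3 X = sym_diff X (h3 (X \<inter> T) \<inter> R)"
      using T by (auto simp: card_Pow K_def)
    have "circ_act (c1 @ c2 @ c3) v = \<beta> v" if v: "v \<in> \<V>" for v
    proof -
      have \<beta>T: "\<beta> v \<subseteq> T" using \<beta> v by (auto simp: bij_betw_def)
      have "h2 (v \<inter> R) = \<beta> v" using inv_into_f_f[OF inj v] by (simp add: h2_def)
      moreover have "v \<inter> R \<inter> R \<in> \<P>" using v by (auto simp: \<P>_def)
      ultimately have "circ_act c2 (v \<inter> R) = sym_diff (v \<inter> R) (\<beta> v \<inter> T)"
        using c2(3)[of "v \<inter> R"] by (simp add: Int_assoc)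
      also have "\<dots> = (v \<inter> R) \<union> \<beta> v" using \<beta>T T(2) by auto
      finally have 2: "circ_act c2 (v \<inter> R) = (v \<inter> R) \<union> \<beta> v" .
      have "((v \<inter> R) \<union> \<beta> v) \<inter> T = \<beta> v" using \<beta>T T(2) by auto
      moreover have "h3 (\<beta> v) = v" using \<beta> v by (simp add: h3_def bij_betw_def)
      ultimately have "circ_act c3 ((v \<inter> R) \<union> \<beta> v) = sym_diff ((v \<inter> R) \<union> \<beta> v) (v \<inter> R)"
        by (simp add: c3)
      also have "\<dots> = \<beta> v" using \<beta>T T(2) by auto
      finally show ?thesis using c1(5)[OF v] 2 by simp
    qed
    \<comment> \<open>\<open>45 = 1 + 22 + 22\<close>: the clearing CNOTs and the two
      lookups.\<close>
    moreover have "length (c1 @ c2 @ c3) \<le> 45 * m"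
    proof -
      have "10 * card R + 12 \<le> 22 * M" using c1(2) KM sK by linarith
      then have "length c2 \<le> K * (K * (22 * M))"
        using c2(2) sK by (meson less_imp_le mult_le_mono order.refl order_trans)
      moreover have "10 * s + 12 \<le> 22 * K" using sK by linarith
      then have "length c3 \<le> M * (K * (22 * K))"
        using c3(2) c1(2) by (meson mult_le_mono order.refl order_trans)
      moreover have "K * (K * (22 * M)) = 22 * (M * K\<^sup>2)" "M * (K * (22 * K)) = 22 * (M * K\<^sup>2)"
        by (simp_all add: power2_eq_square)
      ultimately show ?thesis using c1(4) M3 by simp
    qed
    ultimately show ?thesis using c1(3) c2(1) c3(1)
      by (intro exI[of _ "c1 @ c2 @ c3"]) (simp del: circ_act_simps)
  qed
  then show ?thesis using T by blast
qed

section \<open>Realizing one block with linearly many gates\<close>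

definition realizes :: "nat \<Rightarrow> gate list \<Rightarrow> (nat set \<Rightarrow> nat set) \<Rightarrow> bool" where
  "realizes m c p \<longleftrightarrow> valid_circuit m c \<and> (\<forall>v\<subseteq>{..<m}. circ_act c v = p v)"

text \<open>A block is a product of \<open>k\<close> disjoint transpositions; \<open>A\<close> selects one point of each.\<close>

definition is_block :: "nat \<Rightarrow> nat \<Rightarrow> (nat set \<Rightarrow> nat set) \<Rightarrow> bool" where
  "is_block m k p \<longleftrightarrow> (\<exists>A\<subseteq>Pow {..<m}. card A = k \<and> p ` A \<subseteq> Pow {..<m} \<and> p ` A \<inter> A = {} \<and>
      (\<forall>v. p (p v) = v) \<and> (\<forall>v. v \<notin> A \<union> p ` A \<longrightarrow> p v = v))"

text \<open>The circuit is a multi-controlled NOT conjugated by \<open>e\<close>. Here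
  \<open>e\<close> encodes \<open>\<V>\<close> by subsets of \<open>T\<close>, partners differing in
  \<open>t\<close> alone, and sets all lines \<open>N\<close> outside \<open>T\<close>; a NOT on
  \<open>t\<close> controlled by \<open>N\<close> then swaps all pairs at once.\<close>

lemma block_realizable:
  assumes "is_block m (2 ^ r) p" and r: "r \<ge> 1" and m: "(2 ^ 2 ^ (r + 1)) ^ 3 \<le> m"
  shows "\<exists>c. realizes m c p \<and> length c \<le> 112 * m"
proof -
  obtain A where A: "A \<subseteq> Pow {..<m}" "card A = 2 ^ r" "p ` A \<subseteq> Pow {..<m}" "p ` A \<inter> A = {}"
    "\<And>v. p (p v) = v" "\<And>v. v \<notin> A \<union> p ` A \<Longrightarrow> p v = v"
    using assms(1) unfolding is_block_def by blast
  define \<V> where "\<V> = A \<union> p ` A"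
  have finA: "finite A" using A(2) by (metis card.infinite power_not_zero zero_neq_numeral)
  have injp: "inj_on p S" for S using A(5) by (metis inj_onI)
  have VV: "\<V> \<subseteq> Pow {..<m}" using A(1,3) by (auto simp: \<V>_def)
  have cV: "card \<V> = 2 ^ (r + 1)"
    unfolding \<V>_def using card_Un_disjoint[of A "p ` A"] A(2,4) finA card_image[OF injp[of A]]
    by (simp add: Int_commute)
  obtain T where T: "T \<subseteq> {..<m}" "card T = r + 1" and
    enc: "\<And>\<beta>. bij_betw \<beta> \<V> (Pow T) \<Longrightarrow>
      \<exists>c. valid_circuit m c \<and> length c \<le> 45 * m \<and> (\<forall>v\<in>\<V>. circ_act c v = \<beta> v)"
    using exists_encoding_circuit[OF VV cV _ m] r by auto
  have finT: "finite T" using T finite_subset by blast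
  obtain t where t: "t \<in> T" using T by fastforce
  define T' where "T' = T - {t}"
  have cT': "card T' = r" using T t by (simp add: T'_def)
  \<comment> \<open>The idle line for the NOT controlled by \<open>N\<close>; it exists because
    \<open>r \<ge> 1\<close>.\<close>
  then obtain d where d: "d \<in> T'" using r by fastforce
  have "card A = card (Pow T')" using A(2) cT' finT by (simp add: card_Pow T'_def)
  then obtain \<gamma> where \<gamma>: "bij_betw \<gamma> A (Pow T')"
    using finite_same_card_bij[of A "Pow T'"] finA finT by (auto simp: T'_def)
  define \<beta> where "\<beta> v = (if v \<in> A then \<gamma> v else insert t (\<gamma> (p v)))" for v
  have \<gamma>T: "\<gamma> v \<subseteq> T'" if "v \<in> A" for v using \<gamma> that by (auto simp: bij_betw_def)
  have b1: "bij_betw \<beta> A (Pow T')"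
    using \<gamma> by (subst bij_betw_cong[of A \<beta> \<gamma>]) (auto simp: \<beta>_def)
  have b2: "bij_betw \<beta> (p ` A) (insert t ` Pow T')"
  proof -
    have "bij_betw p (p ` A) A" using injp A(5) by (auto simp: bij_betw_def image_image)
    moreover have "bij_betw (insert t) (Pow T') (insert t ` Pow T')"
      by (rule inj_on_imp_bij_betw) (auto simp: inj_on_def T'_def)
    ultimately have "bij_betw (insert t \<circ> (\<gamma> \<circ> p)) (p ` A) (insert t ` Pow T')"
      using \<gamma> bij_betw_trans by blast
    then show ?thesis by (subst bij_betw_cong[of _ _ "insert t \<circ> (\<gamma> \<circ> p)"]) (use A(4) in \<open>auto simp: \<beta>_def\<close>)
  qed
  have PT: "Pow T = Pow T' \<union> insert t ` Pow T'"
    using t Pow_insert[of t T'] by (simp add: T'_def insert_absorb)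
  have \<beta>: "bij_betw \<beta> \<V> (Pow T)"
    unfolding \<V>_def PT by (rule bij_betw_combine[OF b1 b2]) (auto simp: T'_def)
  have \<beta>p: "\<beta> (p v) = sym_diff (\<beta> v) {t}" if "v \<in> \<V>" for v
    using that \<gamma>T A(4,5) by (auto simp: \<V>_def \<beta>_def T'_def)
  have pV: "p v \<in> \<V>" if "v \<in> \<V>" for v using that A(5) by (auto simp: \<V>_def)
  obtain c1 where c1: "valid_circuit m c1" "length c1 \<le> 45 * m" "\<And>v. v \<in> \<V> \<Longrightarrow> circ_act c1 v = \<beta> v"
    using enc[OF \<beta>] by blast
  define N where "N = {..<m} - T"
  have N: "N \<subseteq> {..<m}" by (auto simp: N_def)
  have cN: "card N \<le> m" using card_mono[OF _ N] by simp
  obtain c2 where c2: "valid_circuit m c2" "length c2 \<le> card N" "\<And>X. circ_act c2 X = sym_diff X N"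
    using exists_not_circuit[OF N] by blast
  obtain c3 where c3: "valid_circuit m c3" "length c3 \<le> 8 * card N + 12" "circ_act c3 = gate_act (N, t)"
    using exists_mcx[OF N, of t d] t d T by (auto simp: N_def T'_def)
  define e where "e = c1 @ c2"
  have ve: "valid_circuit m e" using c1 c2 by (simp add: e_def)
  have eV: "circ_act e v = \<beta> v \<union> N" "\<beta> v \<subseteq> T" if "v \<in> \<V>" for v
  proof -
    show "\<beta> v \<subseteq> T" using \<beta> that by (auto simp: bij_betw_def)
    then show "circ_act e v = \<beta> v \<union> N" using that by (auto simp: e_def c1 c2 N_def)
  qed
  have "circ_act (e @ c3 @ rev e) v = p v" if v: "v \<subseteq> {..<m}" for v
  proof (cases "v \<in> \<V>")
    case True
    have "gate_act (N, t) (\<beta> v \<union> N) = sym_diff (\<beta> v \<union> N) {t}" by (simp add: gate_act_def)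
    also have "\<dots> = sym_diff (\<beta> v) {t} \<union> N" using t by (auto simp: N_def)
    also have "\<dots> = circ_act e (p v)" using eV(1)[OF pV[OF True]] \<beta>p[OF True] by simp
    finally show ?thesis using eV(1)[OF True] by (simp add: c3 circ_act_rev[OF ve])
  next
    case False
    \<comment> \<open>The codes exhaust \<open>Pow T\<close>, so an image containing
      \<open>N\<close> is already the image of some \<open>w\<close> in \<open>\<V>\<close>;
      injectivity of \<open>e\<close> would put \<open>v\<close> into \<open>\<V>\<close>.\<close>
    have "\<not> N \<subseteq> circ_act e v"
    proof
      assume sub: "N \<subseteq> circ_act e v"
      have "circ_act e v \<subseteq> {..<m}" by (rule circ_act_subset[OF ve v])
      then have eq: "circ_act e v = (circ_act e v \<inter> T) \<union> N" using sub by (auto simp: N_def)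
      have "circ_act e v \<inter> T \<in> \<beta> ` \<V>" using \<beta> by (auto simp: bij_betw_def)
      then obtain w where w: "w \<in> \<V>" "\<beta> w = circ_act e v \<inter> T" by auto
      then have "circ_act e w = circ_act e v" using eV(1)[OF w(1)] eq by simp
      then show False using inj_circ_act[OF ve] w False by (auto dest: injD)
    qed
    then have "gate_act (N, t) (circ_act e v) = circ_act e v" by (simp add: gate_act_def)
    moreover have "p v = v" by (rule A(6)) (use False in \<open>simp add: \<V>_def\<close>)
    ultimately show ?thesis by (simp add: c3 circ_act_rev[OF ve])
  qed
  moreover have "valid_circuit m (e @ c3 @ rev e)" using ve c3 by simp
  \<comment> \<open>\<open>112 = 2 * (45 + 1) + 8 + 12\<close>: \<open>e\<close> and its reverse,
    then the controlled NOT with its additive 12.\<close>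
  moreover have "length (e @ c3 @ rev e) \<le> 112 * m"
  proof -
    have "1 \<le> m" using m by (metis less_one linorder_not_less le_zero_eq power_not_zero zero_neq_numeral)
    then show ?thesis using c1(2) c2(2) c3(2) cN by (simp add: e_def)
  qed
  ultimately show ?thesis unfolding realizes_def by blast
qed

section \<open>Parity and greedy synthesis\<close>

lemma involution_permutes:
  assumes "\<And>v. h (h v) = v" "\<And>v. v \<notin> S \<Longrightarrow> h v = v"
  shows "h permutes S"
proof -
  have "\<exists>!x. h x = y" for y by (rule ex1I[of _ "h y"]) (use assms(1) in auto)
  then show ?thesis using assms(2) by (simp add: permutes_def)
qed

lemma exists_mem_diff:
  assumes "finite X" "card X < card Y" shows "\<exists>y\<in>Y. y \<notin> X"
proof (rule ccontr)
  assume "\<not> ?thesis"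
  then have "Y \<subseteq> X" by blast
  then show False using card_mono[OF assms(1)] assms(2) by (simp add: leD)
qed

section \<open>Parity of circuits\<close>

text \<open>\<open>circ_act c\<close> may move infinitely many sets, as lines from \<open>m\<close>
  on can be set; making it the identity outside the cube gives the finite support that parity
  needs.\<close>

definition circ_perm :: "nat \<Rightarrow> gate list \<Rightarrow> nat set \<Rightarrow> nat set" where
  "circ_perm m c v = (if v \<subseteq> {..<m} then circ_act c v else v)"

lemma circ_perm_permutes:
  assumes "valid_circuit m c" shows "circ_perm m c permutes Pow {..<m}"
proof -
  have 1: "circ_perm m (rev c) (circ_perm m c v) = v" for v
    using circ_act_subset[OF assms] circ_act_rev[OF assms] by (auto simp: circ_perm_def)
  have 2: "circ_perm m c (circ_perm m (rev c) v) = v" for v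
    using circ_act_subset[of m "rev c"] circ_act_rev'[OF assms] assms by (auto simp: circ_perm_def)
  have "\<exists>!x. circ_perm m c x = y" for y using 1 2 by metis
  then show ?thesis by (auto simp: permutes_def circ_perm_def)
qed

lemma evenperm_gate:
  assumes g: "valid_gate m (C, t)" and m: "4 \<le> m"
  shows "evenperm (circ_perm m [(C, t)])"
proof -
  have C: "C \<subseteq> {..<m}" "t < m" "t \<notin> C" "card C \<le> 2" using g by (auto simp: valid_gate_iff)
  have "finite C" using C finite_subset by blast
  \<comment> \<open>A gate touches at most three lines, so a fourth one is idle.\<close>
  then have "card (insert t C) < card {..<m}" using C m by simp
  then obtain d where d: "d < m" "d \<notin> C" "d \<noteq> t"
    using exists_mem_diff[of "insert t C" "{..<m}"] \<open>finite C\<close> by auto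
  \<comment> \<open>The gate splits along an idle line \<open>d\<close> into two halves conjugate under NOT on \<open>d\<close>.\<close>
  define h where "h b v = (if v \<subseteq> {..<m} \<and> (d \<in> v \<longleftrightarrow> b) then gate_act (C, t) v else v)" for b v
  define s where "s v = (if v \<subseteq> {..<m} then sym_diff v {d} else v)" for v
  have sub: "gate_act (C, t) v \<subseteq> {..<m}" if "v \<subseteq> {..<m}" for v
    using gate_act_subset[OF g that] .
  have inv: "gate_act (C, t) (gate_act (C, t) v) = v" for v
    using gate_act_gate_act[of "(C, t)"] C by simp
  have dact: "d \<in> gate_act (C, t) v \<longleftrightarrow> d \<in> v" for v using d by (auto simp: gate_act_def)
  have hp: "permutation (h b)" for b
    by (rule permutes_imp_permutation[of "Pow {..<m}"], simp, rule involution_permutes)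
      (auto simp: h_def sub inv dact dest: subsetD[OF sub])
  have sp: "permutation s"
    by (rule permutes_imp_permutation[of "Pow {..<m}"], simp, rule involution_permutes)
      (use d in \<open>auto simp: s_def\<close>)
  have comp: "circ_perm m [(C, t)] = h True \<circ> h False"
    by (rule ext) (auto simp: circ_perm_def h_def dact dest: subsetD[OF sub])
  have ga: "gate_act (C, t) (sym_diff v {d}) = sym_diff (gate_act (C, t) v) {d}" for v
    using d by (auto simp: gate_act_def)
  have conj: "h False = s \<circ> (h True \<circ> s)"
  proof
    fix v
    show "h False v = (s \<circ> (h True \<circ> s)) v"
    proof (cases "v \<subseteq> {..<m}")
      case True
      then have 1: "s v = sym_diff v {d}" "sym_diff v {d} \<subseteq> {..<m}" using d by (auto simp: s_def)
      have 2: "d \<in> sym_diff v {d} \<longleftrightarrow> d \<notin> v" by auto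
      show ?thesis
      proof (cases "d \<in> v")
        case True
        then have "h True (s v) = s v" using 1 2 by (simp add: h_def)
        moreover have "s (s v) = v" using 1 by (auto simp: s_def)
        ultimately show ?thesis using True by (simp add: h_def)
      next
        case False
        then have "s v \<subseteq> {..<m}" "d \<in> s v" unfolding 1(1) using 1(2) by auto
        then have "h True (s v) = gate_act (C, t) (s v)" by (simp add: h_def)
        also have "\<dots> = sym_diff (gate_act (C, t) v) {d}" unfolding 1(1) by (rule ga)
        finally have "h True (s v) = sym_diff (gate_act (C, t) v) {d}" .
        moreover have "s (sym_diff (gate_act (C, t) v) {d}) = gate_act (C, t) v"
          using sub[OF True] d by (auto simp: s_def)
        ultimately show ?thesis using False True by (simp add: h_def)
      qed
    qed (simp add: h_def s_def)
  qed
  \<comment> \<open>Conjugation preserves parity; two factors of equal parity have an even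
    product.\<close>
  have "evenperm (h False) \<longleftrightarrow> evenperm (h True)"
    unfolding conj using hp sp by (auto simp: evenperm_comp permutation_compose)
  then show ?thesis unfolding comp using hp by (simp add: evenperm_comp)
qed

lemma circ_perm_Cons:
  assumes "valid_gate m g" shows "circ_perm m (g # c) = circ_perm m c \<circ> circ_perm m [g]"
proof
  fix v
  show "circ_perm m (g # c) v = (circ_perm m c \<circ> circ_perm m [g]) v"
    by (cases "v \<subseteq> {..<m}") (simp_all add: circ_perm_def gate_act_subset[OF assms])
qed

lemma circ_perm_permutation: "valid_circuit m c \<Longrightarrow> permutation (circ_perm m c)"
  by (rule permutes_imp_permutation[of "Pow {..<m}"]) (simp_all add: circ_perm_permutes)

lemma evenperm_circ_perm:
  assumes "valid_circuit m c" "4 \<le> m" shows "evenperm (circ_perm m c)"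
  using assms(1)
proof (induction c)
  case Nil
  have "circ_perm m [] = id" by (simp add: circ_perm_def fun_eq_iff)
  then show ?case by simp
next
  case (Cons g c)
  then have "evenperm (circ_perm m [g])" using evenperm_gate assms(2) by (cases g) auto
  then show ?case using Cons circ_perm_permutation[of m "[g]"] circ_perm_permutation[of m c]
    by (subst circ_perm_Cons) (simp_all add: evenperm_comp)
qed

text \<open>Lets the greedy argument conclude that a block is even from the mere existence of a
  circuit for it.\<close>

lemma realizes_evenperm:
  assumes "realizes m c p" "p permutes Pow {..<m}" "4 \<le> m" shows "evenperm p"
proof -
  have "p = circ_perm m c"
    using assms(1) permutes_not_in[OF assms(2)] by (auto simp: realizes_def circ_perm_def fun_eq_iff)
  then show ?thesis using assms evenperm_circ_perm by (simp add: realizes_def)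
qed

lemma realizes_comp:
  assumes "realizes m c p" "realizes m c' p'" shows "realizes m (c @ c') (p' \<circ> p)"
proof -
  have "p v \<subseteq> {..<m}" if "v \<subseteq> {..<m}" for v
    using assms(1) circ_act_subset[of m c v] that by (auto simp: realizes_def)
  then show ?thesis using assms by (auto simp: realizes_def)
qed

section \<open>Peeling off transpositions and blocks\<close>

lemma is_block_permutes:
  assumes "is_block m k p" shows "p permutes Pow {..<m}"
proof -
  obtain A where A: "A \<subseteq> Pow {..<m}" "p ` A \<subseteq> Pow {..<m}"
    and inv: "\<And>v. p (p v) = v" and fix': "\<And>v. v \<notin> A \<union> p ` A \<Longrightarrow> p v = v"
    using assms unfolding is_block_def by blast
  show ?thesis
  proof (rule involution_permutes[OF inv])
    fix v assume "v \<notin> Pow {..<m}"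
    then show "p v = v" by (intro fix') (use A in blast)
  qed
qed

lemma is_block_two_transpositions:
  assumes "{a, b, e, f} \<subseteq> Pow {..<m}" "distinct [a, b, e, f]"
  shows "is_block m 2 (transpose a b \<circ> transpose e f)"
  unfolding is_block_def
proof (intro exI[of _ "{a, e}"] conjI allI impI)
  let ?p = "transpose a b \<circ> transpose e f"
  have ne: "a \<noteq> b" "a \<noteq> e" "a \<noteq> f" "b \<noteq> e" "b \<noteq> f" "e \<noteq> f" "b \<noteq> a" "e \<noteq> a" "f \<noteq> a" "e \<noteq> b" "f \<noteq> b" "f \<noteq> e"
    using assms(2) by auto
  have im: "?p ` {a, e} = {b, f}" using assms(2) by (auto simp: transpose_def)
  show "?p ` {a, e} \<subseteq> Pow {..<m}" "?p ` {a, e} \<inter> {a, e} = {}"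
    unfolding im using assms by auto
  show "?p (?p v) = v" for v
    using ne by (cases "v = a"; cases "v = b"; cases "v = e"; cases "v = f") (simp_all add: transpose_def)
  show "?p v = v" if "v \<notin> {a, e} \<union> ?p ` {a, e}" for v
    using that unfolding im by (simp add: transpose_def)
qed (use assms in auto)

text \<open>
  The two transpositions may overlap; inserting a cancelling transposition of two fresh points
  between them yields two genuine blocks.
\<close>

lemma transposition_pair_realizable:
  assumes B: "\<And>p. is_block m 2 p \<Longrightarrow> \<exists>c. realizes m c p \<and> length c \<le> B" and m: "4 \<le> m"
    and ab: "a \<subseteq> {..<m}" "b \<subseteq> {..<m}" "a \<noteq> b" and cd: "c \<subseteq> {..<m}" "d \<subseteq> {..<m}" "c \<noteq> d"
  shows "\<exists>g. realizes m g (transpose a b \<circ> transpose c d) \<and> length g \<le> 2 * B"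
proof -
  have "2 ^ 4 \<le> (2::nat) ^ m" using m by (rule power_increasing) simp
  then have U: "16 \<le> card (Pow {..<m})" by (simp add: card_Pow)
  have fin4: "finite {a, b, c, d}" by simp
  have "card {a, b, c, d} \<le> 4" by (simp add: card_insert_if)
  then have "2 \<le> card (Pow {..<m} - {a, b, c, d})"
    using U diff_card_le_card_Diff[OF fin4, of "Pow {..<m}"] by linarith
  then obtain S where "S \<subseteq> Pow {..<m} - {a, b, c, d}" "card S = 2"
    using obtain_subset_with_card_n by metis
  then obtain e f where ef: "e \<noteq> f" "{e, f} \<subseteq> Pow {..<m} - {a, b, c, d}"
    by (auto simp: card_2_iff)
  have d1: "{e, f, c, d} \<subseteq> Pow {..<m}" and d3: "{a, b, e, f} \<subseteq> Pow {..<m}"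
    and d2: "distinct [e, f, c, d]" "distinct [a, b, e, f]" using ef ab cd by auto
  obtain g1 where g1: "realizes m g1 (transpose e f \<circ> transpose c d)" "length g1 \<le> B"
    using B[of "transpose e f \<circ> transpose c d"] is_block_two_transpositions[OF d1 d2(1)] by blast
  obtain g2 where g2: "realizes m g2 (transpose a b \<circ> transpose e f)" "length g2 \<le> B"
    using B[of "transpose a b \<circ> transpose e f"] is_block_two_transpositions[OF d3 d2(2)] by blast
  have "(transpose a b \<circ> transpose e f) \<circ> (transpose e f \<circ> transpose c d) = transpose a b \<circ> transpose c d"
    by (simp add: fun_eq_iff)
  then show ?thesis using realizes_comp[OF g1(1) g2(1)] g1(2) g2(2)
    by (intro exI[of _ "g1 @ g2"]) simp
qed

text \<open>The new map fixes \<open>x\<close>, and every fixed point of \<open>p\<close> stays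
  fixed, because neither \<open>x\<close> nor \<open>p x\<close> is one.\<close>

lemma transpose_reduces_support:
  assumes "p permutes S" "finite S" "p x \<noteq> x"
  shows "transpose x (p x) \<circ> p permutes S"
    and "card {v. (transpose x (p x) \<circ> p) v \<noteq> v} < card {v. p v \<noteq> v}"
    and "evenperm (transpose x (p x) \<circ> p) \<longleftrightarrow> \<not> evenperm p"
proof -
  have xS: "x \<in> S" "p x \<in> S" using assms(1,3) permutes_not_in permutes_in_image by metis+
  show "transpose x (p x) \<circ> p permutes S"
    using permutes_compose[OF assms(1) permutes_swap_id[OF xS]] .
  have fin: "finite {v. p v \<noteq> v}"
    using assms permutes_not_in by (metis (mono_tags, lifting) finite_subset mem_Collect_eq subsetI)
  have ppx: "p (p x) \<noteq> p x" using assms(3) permutes_inj[OF assms(1)] by (auto dest: injD)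
  have "{v. (transpose x (p x) \<circ> p) v \<noteq> v} \<subseteq> {v. p v \<noteq> v} - {x}"
    using assms(3) ppx by (auto simp: transpose_def split: if_splits)
  then have "card {v. (transpose x (p x) \<circ> p) v \<noteq> v} \<le> card ({v. p v \<noteq> v} - {x})"
    using fin by (intro card_mono) auto
  also have "\<dots> < card {v. p v \<noteq> v}" using fin assms(3) by (intro psubset_card_mono) auto
  finally show "card {v. (transpose x (p x) \<circ> p) v \<noteq> v} < card {v. p v \<noteq> v}" .
  show "evenperm (transpose x (p x) \<circ> p) \<longleftrightarrow> \<not> evenperm p"
    using assms(3) permutes_imp_permutation[OF assms(2,1)]
    by (simp add: evenperm_comp permutation_swap_id evenperm_swap)
qed

text \<open>Removing two transpositions shrinks the support by at least two at cost
  \<open>2 * B\<close>, hence \<open>B\<close> per moved point.\<close>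

lemma evenperm_realizable_by_pairs:
  assumes B: "\<And>p. is_block m 2 p \<Longrightarrow> \<exists>c. realizes m c p \<and> length c \<le> B" and m: "4 \<le> m"
    and "p permutes Pow {..<m}" "evenperm p"
  shows "\<exists>c. realizes m c p \<and> length c \<le> B * card {v. p v \<noteq> v}"
  using assms(3,4)
proof (induction "card {v. p v \<noteq> v}" arbitrary: p rule: less_induct)
  case less
  show ?case
  proof (cases "\<exists>x. p x \<noteq> x")
    case False
    then have "realizes m [] p" by (auto simp: realizes_def)
    then show ?thesis by (intro exI[of _ "[]"]) simp
  next
    case True
    then obtain x where x: "p x \<noteq> x" by auto
    define q where "q = transpose x (p x) \<circ> p"
    have q: "q permutes Pow {..<m}" "card {v. q v \<noteq> v} < card {v. p v \<noteq> v}" "\<not> evenperm q"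
      using transpose_reduces_support[OF less.prems(1) _ x] less.prems(2) by (auto simp: q_def)
    \<comment> \<open>\<open>q\<close> is odd, hence not the identity.\<close>
    obtain y where y: "q y \<noteq> y"
      using q(3) evenperm_id by (metis eq_id_iff)
    define r where "r = transpose y (q y) \<circ> q"
    have r: "r permutes Pow {..<m}" "card {v. r v \<noteq> v} < card {v. q v \<noteq> v}" "evenperm r"
      using transpose_reduces_support[OF q(1) _ y] q(3) by (auto simp: r_def)
    obtain c where c: "realizes m c r" "length c \<le> B * card {v. r v \<noteq> v}"
      using less.hyps[of r] r q by auto
    have in_U: "v \<subseteq> {..<m} \<and> s v \<subseteq> {..<m}" if "s permutes Pow {..<m}" "s v \<noteq> v" for s v
      using that permutes_not_in permutes_in_image by (metis PowD)
    obtain g where g: "realizes m g (transpose x (p x) \<circ> transpose y (q y))" "length g \<le> 2 * B"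
      using transposition_pair_realizable[OF B m, of x "p x" y "q y"]
        in_U[OF less.prems(1) x] in_U[OF q(1) y] x y by metis
    have "(transpose x (p x) \<circ> transpose y (q y)) \<circ> r = p"
      by (simp add: r_def q_def fun_eq_iff)
    then have "realizes m (c @ g) p" using realizes_comp[OF c(1) g(1)] by simp
    moreover have "length (c @ g) \<le> B * card {v. p v \<noteq> v}"
    proof -
      have "B * (card {v. r v \<noteq> v} + 2) \<le> B * card {v. p v \<noteq> v}"
        using r(2) q(2) by (intro mult_left_mono) auto
      then show ?thesis using c(2) g(2) by simp
    qed
    ultimately show ?thesis by blast
  qed
qed

text \<open>Greedy choice: a new point must avoid \<open>A\<close>, its image and its preimage,
  together at most \<open>3 * k\<close> points.\<close>

lemma exists_displaced_subset:
  assumes p: "p permutes S" and fin: "finite S" and k: "3 * k \<le> card {v. p v \<noteq> v}"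
  shows "\<exists>A\<subseteq>{v. p v \<noteq> v}. card A = k \<and> p ` A \<inter> A = {}"
  using k
proof (induction k)
  case 0
  show ?case by (rule exI[of _ "{}"]) simp
next
  case (Suc k)
  then obtain A where A: "A \<subseteq> {v. p v \<noteq> v}" "card A = k" "p ` A \<inter> A = {}" by auto
  have finU: "finite {v. p v \<noteq> v}"
    using fin p permutes_not_in by (metis (mono_tags, lifting) finite_subset mem_Collect_eq subsetI)
  have finA: "finite A" using A finU finite_subset by blast
  have "card (A \<union> p ` A \<union> inv p ` A) \<le> card A + card (p ` A) + card (inv p ` A)"
    by (meson add_le_mono card_Un_le order.refl order_trans)
  also have "\<dots> \<le> 3 * k" using card_image_le[OF finA, of p] card_image_le[OF finA, of "inv p"] A(2) by simp
  finally have "card (A \<union> p ` A \<union> inv p ` A) < card {v. p v \<noteq> v}" using Suc.prems by simp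
  then obtain x where x: "p x \<noteq> x" "x \<notin> A \<union> p ` A \<union> inv p ` A"
    using exists_mem_diff[of "A \<union> p ` A \<union> inv p ` A" "{v. p v \<noteq> v}"] finA by auto
  have "p x \<notin> A" using x(2) permutes_inverses(2)[OF p] by (metis UnI2 imageI)
  then have "p ` insert x A \<inter> insert x A = {}" using A(3) x by auto
  then show ?case using A(1,2) x finA by (intro exI[of _ "insert x A"]) auto
qed

text \<open>Each block fixes \<open>k\<close> more points at cost \<open>B\<close>. Once fewer than
  \<open>3 * k\<close> points move, pairs finish at cost at most \<open>3 * k * B\<close>, the last
  summand. Both sides carry a factor \<open>k\<close> to avoid division.\<close>

lemma evenperm_realizable:
  assumes B: "\<And>p. is_block m 2 p \<Longrightarrow> \<exists>c. realizes m c p \<and> length c \<le> B"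
    and Bk: "\<And>p. is_block m k p \<Longrightarrow> \<exists>c. realizes m c p \<and> length c \<le> B"
    and m: "4 \<le> m" and k: "1 \<le> k" and "p permutes Pow {..<m}" "evenperm p"
  shows "\<exists>c. realizes m c p \<and> k * length c \<le> B * card {v. p v \<noteq> v} + 3 * k * k * B"
  using assms(5,6)
proof (induction "card {v. p v \<noteq> v}" arbitrary: p rule: less_induct)
  case less
  show ?case
  proof (cases "3 * k \<le> card {v. p v \<noteq> v}")
    case False
    obtain c where c: "realizes m c p" "length c \<le> B * card {v. p v \<noteq> v}"
      using evenperm_realizable_by_pairs[OF B m less.prems] by blast
    have le: "B * card {v. p v \<noteq> v} \<le> B * (3 * k)" using False by (intro mult_left_mono) auto
    have "k * length c \<le> k * (B * (3 * k))" by (rule mult_le_mono2[OF order_trans[OF c(2) le]])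
    also have "\<dots> = 3 * k * k * B" by simp
    finally show ?thesis using c(1) trans_le_add2 by blast
  next
    case True
    obtain A where A: "A \<subseteq> {v. p v \<noteq> v}" "card A = k" "p ` A \<inter> A = {}"
      using exists_displaced_subset[OF less.prems(1) _ True] by auto
    have finU: "finite {v. p v \<noteq> v}" using True k by (metis card.infinite le_zero_eq mult_is_0 not_one_le_zero zero_neq_numeral)
    \<comment> \<open>\<open>s\<close> swaps each \<open>v\<close> in \<open>A\<close> with
      \<open>p v\<close>; as \<open>A\<close> misses its image, these transpositions are
      disjoint.\<close>
    define s where "s v = (if v \<in> A then p v else if v \<in> p ` A then inv p v else v)" for v
    have inv: "inv p (p v) = v" "p (inv p v) = v" for v using permutes_inverses[OF less.prems(1)] by auto
    have AU: "v \<subseteq> {..<m}" "p v \<subseteq> {..<m}" if "v \<in> A" for v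
    proof -
      have "p v \<noteq> v" using that A(1) by auto
      then have "v \<in> Pow {..<m}" using permutes_not_in[OF less.prems(1)] by blast
      then show "v \<subseteq> {..<m}" "p v \<subseteq> {..<m}" using permutes_in_image[OF less.prems(1), of v] by auto
    qed
    have s_A: "s ` A = p ` A" by (auto simp: s_def)
    have s_p: "s (p v) = v" if "v \<in> A" for v using that A(3) by (auto simp: s_def inv)
    have s_s: "s (s v) = v" for v
    proof -
      consider "v \<in> A" | w where "v = p w" "w \<in> A" | "v \<notin> A" "v \<notin> p ` A" by auto
      then show ?thesis
      proof cases
        case 1 then show ?thesis using s_p by (simp add: s_def)
      next
        case 2 then show ?thesis using s_p by (simp add: s_def)
      next
        case 3 then show ?thesis by (simp add: s_def)
      qed
    qed
    have blk: "is_block m k s"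
      unfolding is_block_def
    proof (intro exI[of _ A] conjI allI impI)
      fix v assume "v \<notin> A \<union> s ` A"
      then show "s v = v" unfolding s_A by (auto simp: s_def)
    qed (use AU A s_s s_A in auto)
    obtain g where g: "realizes m g s" "length g \<le> B" using Bk[OF blk] by blast
    define q where "q = s \<circ> p"
    have sp: "s permutes Pow {..<m}" by (rule is_block_permutes[OF blk])
    have q: "q permutes Pow {..<m}" unfolding q_def using permutes_compose[OF less.prems(1) sp] .
    have "evenperm q" unfolding q_def
      using realizes_evenperm[OF g(1) sp m] less.prems
        permutes_imp_permutation[OF _ sp] permutes_imp_permutation[OF _ less.prems(1)]
      by (simp add: evenperm_comp)
    \<comment> \<open>On \<open>A\<close>, \<open>s\<close> undoes \<open>p\<close>. A fixed point
      of \<open>p\<close> lies neither in \<open>A\<close> nor in the image of \<open>A\<close>, so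
      \<open>s\<close> fixes it too.\<close>
    have "{v. q v \<noteq> v} \<subseteq> {v. p v \<noteq> v} - A"
    proof
      fix v assume v: "v \<in> {v. q v \<noteq> v}"
      have "v \<notin> A" using v s_p by (auto simp: q_def)
      moreover have "p v \<noteq> v"
      proof
        assume pv: "p v = v"
        have "v \<notin> p ` A" using pv A(1) permutes_inj[OF less.prems(1)] by (auto dest: injD)
        then have "s v = v" using \<open>v \<notin> A\<close> by (simp add: s_def)
        then show False using v pv by (simp add: q_def)
      qed
      ultimately show "v \<in> {v. p v \<noteq> v} - A" by simp
    qed
    then have "card {v. q v \<noteq> v} \<le> card ({v. p v \<noteq> v} - A)" using finU by (intro card_mono) auto
    also have "\<dots> = card {v. p v \<noteq> v} - k"
      using A(1,2) finU by (subst card_Diff_subset) (auto intro: finite_subset)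
    finally have cq: "card {v. q v \<noteq> v} + k \<le> card {v. p v \<noteq> v}" using True by linarith
    obtain c where c: "realizes m c q" "k * length c \<le> B * card {v. q v \<noteq> v} + 3 * k * k * B"
      using less.hyps[of q] cq k q \<open>evenperm q\<close> by auto
    have "s \<circ> q = p" by (simp add: q_def fun_eq_iff s_s)
    then have "realizes m (c @ g) p" using realizes_comp[OF c(1) g(1)] by simp
    moreover have "k * length (c @ g) \<le> B * card {v. p v \<noteq> v} + 3 * k * k * B"
    proof -
      have "k * length g \<le> B * k" using g(2) by simp
      moreover have "B * (card {v. q v \<noteq> v} + k) \<le> B * card {v. p v \<noteq> v}"
        using cq by (intro mult_left_mono) auto
      ultimately show ?thesis using c(2) unfolding length_append distrib_left by linarith
    qed
    ultimately show ?thesis by blast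
  qed
qed

section \<open>Upper bound\<close>

text \<open>Inside \<open>W\<close>, the union of \<open>D\<close> and its image, the complements of
  these two sets have equal size; any bijection between them completes \<open>h\<close> to a
  permutation of \<open>W\<close>.\<close>

lemma inj_on_extends_to_permutation:
  assumes U: "finite U" and D: "D \<subseteq> U" and h: "inj_on h D" "h ` D \<subseteq> U"
  shows "\<exists>p. p permutes U \<and> (\<forall>x\<in>D. p x = h x) \<and> {x. p x \<noteq> x} \<subseteq> D \<union> h ` D"
proof -
  define W where "W = D \<union> h ` D"
  have finD: "finite D" and finW: "finite W" and WU: "W \<subseteq> U"
    using U D h finite_subset by (auto simp: W_def)
  have "card (W - D) = card (W - h ` D)"
    using card_Diff_subset[of D W] card_Diff_subset[of "h ` D" W] card_image[OF h(1)] finD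
    by (auto simp: W_def)
  then obtain b where b: "bij_betw b (W - D) (W - h ` D)"
    using finite_same_card_bij[of "W - D" "W - h ` D"] finW by auto
  define p where "p x = (if x \<in> D then h x else if x \<in> W then b x else x)" for x
  have "bij_betw p D (h ` D)"
    using h(1) by (subst bij_betw_cong[of D p h]) (auto simp: p_def inj_on_imp_bij_betw)
  moreover have "bij_betw p (W - D) (W - h ` D)"
    using b by (subst bij_betw_cong[of "W - D" p b]) (auto simp: p_def)
  ultimately have "bij_betw p (D \<union> (W - D)) (h ` D \<union> (W - h ` D))"
    by (rule bij_betw_combine) auto
  moreover have "D \<union> (W - D) = W" "h ` D \<union> (W - h ` D) = W" by (auto simp: W_def)
  ultimately have bW: "bij_betw p W W" by simp
  have out: "p x = x" if "x \<notin> W" for x using that by (auto simp: p_def W_def)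
  have "p permutes U" using permutes_subset[OF bij_imp_permutes[OF bW out] WU] by simp
  moreover have "{x. p x \<noteq> x} \<subseteq> D \<union> h ` D" using out unfolding W_def by blast
  ultimately show ?thesis by (intro exI[of _ p]) (auto simp: p_def)
qed

text \<open>If the extension is odd, first swapping two points outside \<open>D\<close> repairs the
  parity and keeps the values on \<open>D\<close>. These two points account for the
  \<open>+ 2\<close>.\<close>

lemma inj_on_extends_to_evenperm:
  assumes U: "finite U" and D: "D \<subseteq> U" and h: "inj_on h D" "h ` D \<subseteq> U" and two: "2 \<le> card (U - D)"
  shows "\<exists>p. p permutes U \<and> evenperm p \<and> (\<forall>x\<in>D. p x = h x) \<and> card {x. p x \<noteq> x} \<le> 2 * card D + 2"
proof -
  obtain p where p: "p permutes U" "\<And>x. x \<in> D \<Longrightarrow> p x = h x" "{x. p x \<noteq> x} \<subseteq> D \<union> h ` D"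
    using inj_on_extends_to_permutation[OF U D h] by blast
  have finD: "finite D" using U D finite_subset by blast
  have "card (D \<union> h ` D) \<le> 2 * card D"
    using card_Un_le[of D "h ` D"] card_image_le[OF finD, of h] by linarith
  obtain S where "S \<subseteq> U - D" "card S = 2" using two obtain_subset_with_card_n by metis
  then obtain u v where uv: "u \<noteq> v" "u \<in> U - D" "v \<in> U - D" by (auto simp: card_2_iff)
  show ?thesis
  proof (cases "evenperm p")
    case True
    have "card {x. p x \<noteq> x} \<le> card (D \<union> h ` D)" by (rule card_mono[OF _ p(3)]) (use finD in auto)
    then show ?thesis using True p \<open>card (D \<union> h ` D) \<le> 2 * card D\<close> by (intro exI[of _ p]) auto
  next
    case False
    define q where "q = p \<circ> transpose u v"
    have q: "q permutes U" unfolding q_def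
      by (rule permutes_compose[OF permutes_swap_id p(1)]) (use uv in auto)
    have "evenperm q" unfolding q_def
      using False uv(1) permutes_imp_permutation[OF U p(1)]
      by (simp add: evenperm_comp permutation_swap_id evenperm_swap)
    moreover have "q x = h x" if "x \<in> D" for x
    proof -
      have "x \<noteq> u" "x \<noteq> v" using uv that by auto
      then show ?thesis using p(2)[OF that] by (simp add: q_def transpose_def)
    qed
    moreover have "card {x. q x \<noteq> x} \<le> 2 * card D + 2"
    proof -
      have "{x. q x \<noteq> x} \<subseteq> (D \<union> h ` D) \<union> {u, v}"
        using p(3) by (auto simp: q_def transpose_def split: if_splits)
      then have "card {x. q x \<noteq> x} \<le> card ((D \<union> h ` D) \<union> {u, v})"
        by (rule card_mono[rotated]) (use finD in auto)
      also have "\<dots> \<le> card (D \<union> h ` D) + card {u, v}" by (rule card_Un_le)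
      finally show ?thesis using \<open>card (D \<union> h ` D) \<le> 2 * card D\<close> uv(1) by simp
    qed
    ultimately show ?thesis using q by blast
  qed
qed

lemma evenperm_realizable_dyadic:
  assumes r: "1 \<le> r" and m: "(2 ^ 2 ^ (r + 1)) ^ 3 \<le> m" and p: "p permutes Pow {..<m}" "evenperm p"
  shows "\<exists>c. realizes m c p \<and>
    2 ^ r * length c \<le> 112 * m * card {v. p v \<noteq> v} + 3 * 2 ^ r * 2 ^ r * (112 * m)"
proof (rule evenperm_realizable[OF _ _ _ _ p])
  \<comment> \<open>Blocks of two transpositions, which handle the leftover, are the case
    \<open>r = 1\<close>; their size condition follows from the one for \<open>r\<close>.\<close>
  have "(2::nat) ^ 2 ^ (1 + 1) \<le> 2 ^ 2 ^ (r + 1)" using r by (intro power_increasing) auto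
  then have "((2::nat) ^ 2 ^ (1 + 1)) ^ 3 \<le> (2 ^ 2 ^ (r + 1)) ^ 3" by (rule power_mono) simp
  then have m1: "((2::nat) ^ 2 ^ (1 + 1)) ^ 3 \<le> m" using m by (rule order_trans)
  then show "4 \<le> m" by simp
  show "\<exists>c. realizes m c p \<and> length c \<le> 112 * m" if "is_block m 2 p" for p
    using block_realizable[OF _ _ m1] that by simp
  show "\<exists>c. realizes m c p \<and> length c \<le> 112 * m" if "is_block m (2 ^ r) p" for p
    by (rule block_realizable[OF that r m])
qed simp

text \<open>\<open>n < m\<close> leaves at least two points outside the domain for the parity
  correction, and \<open>m \<le> 2 * n\<close> turns the factor \<open>112 * m\<close> into
  \<open>224 * n\<close>.\<close>

lemma inj_on_realizable:
  assumes r: "1 \<le> r" and n: "(2 ^ 2 ^ (r + 1)) ^ 3 \<le> n" and m: "n < m" "m \<le> 2 * n"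
    and h: "inj_on h (Pow {..<n})" "h ` Pow {..<n} \<subseteq> Pow {..<m}"
  shows "\<exists>c. valid_circuit m c \<and> 2 ^ r * length c \<le> 224 * n * (2 ^ (n + 2) + 3 * 2 ^ r * 2 ^ r) \<and>
    (\<forall>X\<subseteq>{..<n}. circ_act c X = h X)"
proof -
  have sub: "Pow {..<n} \<subseteq> Pow {..<m}" using m by auto
  have n1: "1 \<le> n" using n by (metis le_zero_eq not_less_eq_eq One_nat_def power_not_zero zero_neq_numeral)
  have "(2::nat) ^ (n + 1) \<le> 2 ^ m" using m by (intro power_increasing) auto
  moreover have "(2::nat) ^ 1 \<le> 2 ^ n" using n1 by (intro power_increasing) auto
  ultimately have "2 \<le> card (Pow {..<m} - Pow {..<n})"
    using card_Diff_subset[OF _ sub] by (simp add: card_Pow)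
  then obtain p where p: "p permutes Pow {..<m}" "evenperm p" "\<And>X. X \<in> Pow {..<n} \<Longrightarrow> p X = h X"
    "card {x. p x \<noteq> x} \<le> 2 * card (Pow {..<n}) + 2"
    using inj_on_extends_to_evenperm[OF _ sub h] by auto
  have supp: "card {x. p x \<noteq> x} \<le> 2 ^ (n + 2)"
    using p(4) \<open>(2::nat) ^ 1 \<le> 2 ^ n\<close> by (simp add: card_Pow)
  have "(2 ^ 2 ^ (r + 1)) ^ 3 \<le> m" using n m(1) by linarith
  then obtain c where c: "realizes m c p"
    "2 ^ r * length c \<le> 112 * m * card {v. p v \<noteq> v} + 3 * 2 ^ r * 2 ^ r * (112 * m)"
    using evenperm_realizable_dyadic[OF r _ p(1,2)] by blast
  have "2 ^ r * length c \<le> 112 * m * (card {v. p v \<noteq> v} + 3 * 2 ^ r * 2 ^ r)"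
    using c(2) by (simp add: algebra_simps)
  also have "\<dots> \<le> 224 * n * (2 ^ (n + 2) + 3 * 2 ^ r * 2 ^ r)"
  proof (rule mult_le_mono)
    show "112 * m \<le> 224 * n" using m(2) by simp
    show "card {v. p v \<noteq> v} + 3 * 2 ^ r * 2 ^ r \<le> 2 ^ (n + 2) + 3 * 2 ^ r * 2 ^ r" using supp by simp
  qed
  finally have "2 ^ r * length c \<le> 224 * n * (2 ^ (n + 2) + 3 * 2 ^ r * 2 ^ r)" .
  moreover have "valid_circuit m c" using c(1) by (simp add: realizes_def)
  moreover have "circ_act c X = h X" if "X \<subseteq> {..<n}" for X
  proof -
    have "X \<subseteq> {..<m}" using that sub by blast
    then show ?thesis using c(1) p(3)[of X] that by (simp add: realizes_def)
  qed
  ultimately show ?thesis by blast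
qed

lemma exists_short_circuit:
  assumes r: "1 \<le> r" and n: "(2 ^ 2 ^ (r + 1)) ^ 3 \<le> n" and c: "valid_circuit (n + q) c"
  shows "\<exists>c'. valid_circuit (n + q) c' \<and> 2 ^ r * length c' \<le> 224 * n * (2 ^ (n + 2) + 3 * 2 ^ r * 2 ^ r) \<and>
    (\<forall>X\<subseteq>{..<n}. circ_act c' X \<inter> {..<n} = circ_act c X \<inter> {..<n})"
proof -
  have "(2::nat) ^ 2 ^ (1 + 1) \<le> 2 ^ 2 ^ (r + 1)" using r by (intro power_increasing) auto
  then have "((2::nat) ^ 2 ^ (1 + 1)) ^ 3 \<le> (2 ^ 2 ^ (r + 1)) ^ 3" by (rule power_mono) simp
  then have "((2::nat) ^ 2 ^ (1 + 1)) ^ 3 \<le> n" using n by (rule order_trans)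
  then have n4: "4 \<le> n" by simp
  \<comment> \<open>For \<open>q = 0\<close> the permutation of \<open>c\<close> is already even. Up
    to \<open>n\<close> extra lines, the full output of \<open>c\<close> serves as the injection.
    Beyond that only \<open>2 * n\<close> lines are used, since the length bound grows with the
    number of lines.\<close>
  consider "q = 0" | "0 < q" "q \<le> n" | "n < q" by linarith
  then show ?thesis
  proof cases
    case 1
    then have v: "valid_circuit n c" using c by simp
    obtain c' where c': "realizes n c' (circ_perm n c)"
      "2 ^ r * length c' \<le> 112 * n * card {v. circ_perm n c v \<noteq> v} + 3 * 2 ^ r * 2 ^ r * (112 * n)"
      using evenperm_realizable_dyadic[OF r n circ_perm_permutes[OF v] evenperm_circ_perm[OF v n4]] by blast
    have "card {v. circ_perm n c v \<noteq> v} \<le> card (Pow {..<n})"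
      by (rule card_mono) (auto simp: circ_perm_def split: if_splits)
    also have "\<dots> \<le> 2 ^ (n + 2)" by (simp add: card_Pow)
    finally have supp: "card {v. circ_perm n c v \<noteq> v} \<le> 2 ^ (n + 2)" .
    have "2 ^ r * length c' \<le> 112 * n * (card {v. circ_perm n c v \<noteq> v} + 3 * 2 ^ r * 2 ^ r)"
      using c'(2) by (simp add: algebra_simps)
    also have "\<dots> \<le> 224 * n * (2 ^ (n + 2) + 3 * 2 ^ r * 2 ^ r)"
    proof (rule mult_le_mono)
      show "card {v. circ_perm n c v \<noteq> v} + 3 * 2 ^ r * 2 ^ r \<le> 2 ^ (n + 2) + 3 * 2 ^ r * 2 ^ r"
        using supp by simp
    qed simp
    finally show ?thesis using c'(1) 1 by (intro exI[of _ c']) (auto simp: realizes_def circ_perm_def)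
  next
    case 2
    have "\<exists>c'. valid_circuit (n + q) c' \<and> 2 ^ r * length c' \<le> 224 * n * (2 ^ (n + 2) + 3 * 2 ^ r * 2 ^ r) \<and>
        (\<forall>X\<subseteq>{..<n}. circ_act c' X = circ_act c X)"
    proof (rule inj_on_realizable[OF r n])
      show "inj_on (circ_act c) (Pow {..<n})" using inj_circ_act[OF c] by (rule inj_on_subset) simp
      show "circ_act c ` Pow {..<n} \<subseteq> Pow {..<n + q}"
      proof (clarsimp)
        fix X x assume "X \<subseteq> {..<n}" "x \<in> circ_act c X"
        then show "x < n + q" using circ_act_subset[OF c, of X] by fastforce
      qed
    qed (use 2 in auto)
    then show ?thesis by metis
  next
    case 3
    \<comment> \<open>Lines \<open>n\<close> to \<open>2 * n - 1\<close> receive a copy of the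
      input, which makes \<open>h\<close> injective whatever the first \<open>n\<close> outputs
      are.\<close>
    define h where "h X = (circ_act c X \<inter> {..<n}) \<union> (+) n ` X" for X
    have "\<exists>c'. valid_circuit (2 * n) c' \<and> 2 ^ r * length c' \<le> 224 * n * (2 ^ (n + 2) + 3 * 2 ^ r * 2 ^ r) \<and>
        (\<forall>X\<subseteq>{..<n}. circ_act c' X = h X)"
    proof (rule inj_on_realizable[OF r n])
      show "inj_on h (Pow {..<n})"
      proof (rule inj_onI)
        fix X Y assume "h X = h Y"
        moreover have "{i. n + i \<in> h Z} = Z" for Z by (auto simp: h_def)
        ultimately show "X = Y" by metis
      qed
      show "h ` Pow {..<n} \<subseteq> Pow {..<2 * n}" by (auto simp: h_def)
    qed (use n4 in auto)
    then obtain c' where c': "valid_circuit (2 * n) c'"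
      "2 ^ r * length c' \<le> 224 * n * (2 ^ (n + 2) + 3 * 2 ^ r * 2 ^ r)"
      "\<forall>X\<subseteq>{..<n}. circ_act c' X = h X" by blast
    have "h X \<inter> {..<n} = circ_act c X \<inter> {..<n}" for X by (auto simp: h_def)
    then show ?thesis using c' valid_circuit_mono[OF c'(1), of "n + q"] 3 by (intro exI[of _ c']) auto
  qed
qed

section \<open>Bit vectors as sets of lines\<close>

definition bits :: "bool list \<Rightarrow> nat set" where
  "bits xs = {i. i < length xs \<and> xs ! i}"

lemma bits_subset: "bits xs \<subseteq> {..<length xs}"
  by (auto simp: bits_def)

lemma bits_inject:
  assumes "length xs = length ys" "bits xs = bits ys" shows "xs = ys"
proof (rule nth_equalityI[OF assms(1)])
  fix i assume "i < length xs"
  moreover have "i \<in> bits xs \<longleftrightarrow> i \<in> bits ys" using assms(2) by simp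
  ultimately show "xs ! i = ys ! i" using assms(1) by (simp add: bits_def)
qed

lemma bits_surj: "X \<subseteq> {..<n} \<Longrightarrow> \<exists>xs. length xs = n \<and> bits xs = X"
  by (rule exI[of _ "map (\<lambda>i. i \<in> X) [0..<n]"]) (auto simp: bits_def)

lemma bits_append_False: "bits (xs @ replicate q False) = bits xs"
proof (rule set_eqI)
  fix i
  show "i \<in> bits (xs @ replicate q False) \<longleftrightarrow> i \<in> bits xs"
    by (cases "i < length xs") (auto simp: bits_def nth_append)
qed

lemma bits_take: "bits (take n xs) = bits xs \<inter> {..<n}"
  by (auto simp: bits_def)

lemma length_run_circuit: "length (run_circuit c xs) = length xs"
proof (induction c arbitrary: xs)
  case (Cons g c)
  then show ?case by (cases g) (simp add: run_circuit_def apply_gate_def)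
qed (simp add: run_circuit_def)

lemma bits_run_circuit:
  "valid_circuit (length xs) c \<Longrightarrow> bits (run_circuit c xs) = circ_act c (bits xs)"
proof (induction c arbitrary: xs)
  case (Cons g c)
  obtain C t where g: "g = (C, t)" by (cases g)
  have v: "C \<subseteq> {..<length xs}" "t < length xs" using Cons.prems g by (auto simp: valid_gate_iff)
  have "(\<forall>i\<in>C. xs ! i) \<longleftrightarrow> C \<subseteq> bits xs" using v by (auto simp: bits_def)
  then have "bits (apply_gate g xs) = gate_act g (bits xs)"
    using v by (auto simp: g apply_gate_def gate_act_def bits_def nth_list_update split: if_splits)
  moreover have "length (apply_gate g xs) = length xs" by (simp add: g apply_gate_def)
  ultimately show ?case using Cons by (simp add: run_circuit_def)
qed (simp add: run_circuit_def)

lemma bits_output: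
  assumes "valid_circuit (n + q) c" "length xs = n"
  shows "bits (take n (run_circuit c (xs @ replicate q False))) = circ_act c (bits xs) \<inter> {..<n}"
  using bits_run_circuit[of "xs @ replicate q False" c] assms by (simp add: bits_take bits_append_False)

lemma implements_iff:
  "implements n q c f \<longleftrightarrow> valid_circuit (n + q) c \<and>
    (\<forall>xs. length xs = n \<longrightarrow> take n (run_circuit c (xs @ replicate q False)) = f xs)"
  by (simp add: implements_def valid_circuit_def)

lemma implements_transfer:
  assumes f: "implements n q c f" and c': "valid_circuit (n + q) c'"
    and eq: "\<And>X. X \<subseteq> {..<n} \<Longrightarrow> circ_act c' X \<inter> {..<n} = circ_act c X \<inter> {..<n}"
  shows "implements n q c' f"
  unfolding implements_iff
proof (intro conjI c' allI impI)
  fix xs :: "bool list" assume xs: "length xs = n"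
  have c: "valid_circuit (n + q) c" using f by (simp add: implements_iff)
  have "take n (run_circuit c' (xs @ replicate q False)) = take n (run_circuit c (xs @ replicate q False))"
    by (rule bits_inject)
      (use xs bits_output[OF c xs] bits_output[OF c' xs] eq[of "bits xs"] bits_subset[of xs]
        in \<open>auto simp: length_run_circuit\<close>)
  then show "take n (run_circuit c' (xs @ replicate q False)) = f xs"
    using f xs by (simp add: implements_iff)
qed

lemma complexity_le: "implements n q c f \<Longrightarrow> complexity n q f \<le> length c"
  unfolding complexity_def by (rule Least_le) blast

lemma complexity_attained:
  assumes "f \<in> Fset n q" shows "\<exists>c. implements n q c f \<and> length c = complexity n q f"
proof -
  obtain c where "implements n q c f" using assms by (auto simp: Fset_def)
  then have "\<exists>c'. length c' = length c \<and> implements n q c' f" by blast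
  then have "\<exists>c'. length c' = complexity n q f \<and> implements n q c' f"
    unfolding complexity_def by (rule LeastI)
  then show ?thesis by blast
qed

lemma complexity_upper:
  assumes r: "1 \<le> r" and n: "(2 ^ 2 ^ (r + 1)) ^ 3 \<le> n" and f: "f \<in> Fset n q"
  shows "2 ^ r * complexity n q f \<le> 224 * n * (2 ^ (n + 2) + 3 * 2 ^ r * 2 ^ r)"
proof -
  obtain c where c: "implements n q c f" using f by (auto simp: Fset_def)
  then have "valid_circuit (n + q) c" by (simp add: implements_iff)
  then obtain c' where c': "valid_circuit (n + q) c'"
    "2 ^ r * length c' \<le> 224 * n * (2 ^ (n + 2) + 3 * 2 ^ r * 2 ^ r)"
    "\<forall>X\<subseteq>{..<n}. circ_act c' X \<inter> {..<n} = circ_act c X \<inter> {..<n}"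
    using exists_short_circuit[OF r n] by blast
  have "complexity n q f \<le> length c'"
    by (rule complexity_le[OF implements_transfer[OF c c'(1)]]) (use c'(3) in blast)
  then have "2 ^ r * complexity n q f \<le> 2 ^ r * length c'" by (rule mult_le_mono2)
  then show ?thesis using c'(2) by (rule order_trans)
qed

section \<open>Lower bound by counting\<close>

lemma finite_valid_gates: "finite {g. valid_gate w g}"
  and card_valid_gates_le: "card {g. valid_gate w g} \<le> (w + 1) ^ 3"
proof -
  let ?T = "{..w} \<times> {..w} \<times> {..w}"
  \<comment> \<open>The index \<open>w\<close> is a dummy that the intersection removes, so pairs
    \<open>a\<close>, \<open>b\<close> cover control sets of size 0, 1 and 2.\<close>
  let ?F = "\<lambda>(a, b, t). ({a, b} \<inter> {..<w}, t)"
  have sub: "{g. valid_gate w g} \<subseteq> ?F ` ?T"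
  proof
    fix g assume "g \<in> {g. valid_gate w g}"
    moreover obtain C t where g: "g = (C, t)" by (cases g)
    ultimately have C: "C \<subseteq> {..<w}" "t < w" "card C \<le> 2" by (auto simp: valid_gate_iff)
    have finC: "finite C" using C(1) finite_subset by blast
    have "\<exists>a\<le>w. \<exists>b\<le>w. C = {a, b} \<inter> {..<w}"
    proof -
      consider "card C = 0" | "card C = 1" | "card C = 2" using C(3) by linarith
      then show ?thesis
      proof cases
        case 1
        then have "C = {w, w} \<inter> {..<w}" using finC by auto
        then show ?thesis by blast
      next
        case 2
        then obtain a where "C = {a}" by (auto simp: card_1_singleton_iff)
        then have "a \<le> w" "C = {a, a} \<inter> {..<w}" using C(1) by auto
        then show ?thesis by blast
      next
        case 3
        then obtain a b where "C = {a, b}" by (auto simp: card_2_iff)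
        then have "a \<le> w" "b \<le> w" "C = {a, b} \<inter> {..<w}" using C(1) by auto
        then show ?thesis by blast
      qed
    qed
    then obtain a b where "a \<le> w" "b \<le> w" "C = {a, b} \<inter> {..<w}" by blast
    then have "g = ?F (a, b, t)" "(a, b, t) \<in> ?T" using C(2) by (simp_all add: g)
    then show "g \<in> ?F ` ?T" by blast
  qed
  show fin: "finite {g. valid_gate w g}" by (rule finite_subset[OF sub]) simp
  have "card {g. valid_gate w g} \<le> card (?F ` ?T)" by (rule card_mono[OF _ sub]) simp
  also have "\<dots> \<le> card ?T" by (rule card_image_le) simp
  also have "\<dots> = (w + 1) ^ 3" by (simp add: card_cartesian_product power3_eq_cube)
  finally show "card {g. valid_gate w g} \<le> (w + 1) ^ 3" .
qed

lemma sum_powers_le: "(\<Sum>i\<le>L. G ^ i) \<le> (G + 1 :: nat) ^ L"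
proof (induction L)
  case (Suc L)
  have "G ^ Suc L \<le> G * (G + 1) ^ L" by (simp add: power_mono)
  then have "(\<Sum>i\<le>Suc L. G ^ i) \<le> (G + 1) ^ L + G * (G + 1) ^ L"
    using Suc unfolding sum.atMost_Suc by linarith
  then show ?case by simp
qed simp

lemma card_short_circuits_le:
  "finite {c. valid_circuit w c \<and> length c \<le> L}"
  "card {c. valid_circuit w c \<and> length c \<le> L} \<le> ((w + 1) ^ 3 + 1) ^ L"
proof -
  have eq: "{c. valid_circuit w c \<and> length c \<le> L} = {c. set c \<subseteq> {g. valid_gate w g} \<and> length c \<le> L}"
    by (auto simp: valid_circuit_def)
  show "finite {c. valid_circuit w c \<and> length c \<le> L}"
    unfolding eq by (rule finite_lists_length_le[OF finite_valid_gates])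
  have "card {c. valid_circuit w c \<and> length c \<le> L} = (\<Sum>i\<le>L. card {g. valid_gate w g} ^ i)"
    unfolding eq by (rule card_lists_length_le[OF finite_valid_gates])
  also have "\<dots> \<le> (card {g. valid_gate w g} + 1) ^ L" by (rule sum_powers_le)
  also have "\<dots> \<le> ((w + 1) ^ 3 + 1) ^ L" by (rule power_mono) (use card_valid_gates_le in auto)
  finally show "card {c. valid_circuit w c \<and> length c \<le> L} \<le> ((w + 1) ^ 3 + 1) ^ L" .
qed

text \<open>Every even permutation of the cube has a circuit on \<open>n\<close> lines, so it gives
  a member of \<open>Fset n q\<close> and thus a circuit of length at most \<open>L\<close>.
  Different permutations need different circuits.\<close>

lemma fact_le_circuit_count:
  assumes n: "4096 \<le> n" and L: "\<And>f. f \<in> Fset n q \<Longrightarrow> complexity n q f \<le> L"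
  shows "fact (2 ^ n - 2) \<le> ((n + q + 1) ^ 3 + 1) ^ L"
proof -
  define u v :: "nat set" where "u = {}" and "v = {0}"
  define S where "S = Pow {..<n} - {u, v}"
  have uv: "u \<in> Pow {..<n}" "v \<in> Pow {..<n}" "u \<noteq> v" using n by (auto simp: u_def v_def)
  have cS: "card S = 2 ^ n - 2"
    unfolding S_def using uv by (subst card_Diff_subset) (auto simp: card_Pow)
  \<comment> \<open>A permutation of \<open>S\<close> fixes \<open>u\<close> and \<open>v\<close>;
    if it is odd, swapping these two makes it even without changing it on \<open>S\<close>.\<close>
  define ev where "ev p = (if evenperm p then p else p \<circ> transpose u v)" for p
  have ev_S: "ev p x = p x" if "x \<in> S" for p x
    using that by (auto simp: ev_def S_def transpose_def)
  have ev_perm: "ev p permutes Pow {..<n}" "evenperm (ev p)" if "p permutes S" for p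
  proof -
    have p: "p permutes Pow {..<n}" by (rule permutes_subset[OF that]) (auto simp: S_def)
    then have pp: "permutation p" using permutes_imp_permutation by (metis finite_Pow_iff finite_lessThan)
    show "ev p permutes Pow {..<n}"
      using p permutes_compose[OF permutes_swap_id[OF uv(1,2)] p] by (simp add: ev_def)
    show "evenperm (ev p)"
      using pp uv(3) by (simp add: ev_def evenperm_comp permutation_swap_id evenperm_swap)
  qed
  have "\<exists>c. valid_circuit (n + q) c \<and> length c \<le> L \<and> (\<forall>X\<subseteq>{..<n}. circ_act c X \<inter> {..<n} = ev p X)"
    if p: "p permutes S" for p
  proof -
    \<comment> \<open>The size condition for \<open>r = 1\<close> is
      \<open>16 ^ 3 = 4096 \<le> n\<close>; only the existence of a circuit matters here.\<close>
    have "(2 ^ 2 ^ (1 + 1)) ^ 3 \<le> n" using n by simp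
    then obtain c where c: "realizes n c (ev p)"
      using evenperm_realizable_dyadic[of 1 n "ev p"] ev_perm[OF p] by blast
    have v: "valid_circuit n c" using c by (simp add: realizes_def)
    then have v': "valid_circuit (n + q) c" by (rule valid_circuit_mono) simp
    define f where "f xs = take n (run_circuit c (xs @ replicate q False))" for xs
    have f: "implements n q c f" using v' by (simp add: implements_iff f_def)
    then have "f \<in> Fset n q" by (auto simp: Fset_def)
    then obtain c' where c': "implements n q c' f" "length c' \<le> L"
      using complexity_attained L by metis
    have vc': "valid_circuit (n + q) c'" using c'(1) by (simp add: implements_iff)
    have "circ_act c' X \<inter> {..<n} = ev p X" if X: "X \<subseteq> {..<n}" for X
    proof -
      obtain xs where xs: "length xs = n" "bits xs = X" using bits_surj[OF X] by blast
      have "circ_act c' X \<inter> {..<n} = bits (f xs)"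
        using bits_output[OF vc' xs(1)] c'(1) xs by (simp add: implements_iff)
      also have "\<dots> = circ_act c X \<inter> {..<n}"
        using bits_output[OF v' xs(1)] xs by (simp add: f_def)
      also have "\<dots> = circ_act c X" using circ_act_subset[OF v X] by blast
      also have "\<dots> = ev p X" using c X by (simp add: realizes_def)
      finally show ?thesis .
    qed
    then show ?thesis using c'(2) vc' by blast
  qed
  then obtain \<Phi> where \<Phi>: "\<And>p. p permutes S \<Longrightarrow> valid_circuit (n + q) (\<Phi> p)"
    "\<And>p. p permutes S \<Longrightarrow> length (\<Phi> p) \<le> L"
    "\<And>p X. p permutes S \<Longrightarrow> X \<subseteq> {..<n} \<Longrightarrow> circ_act (\<Phi> p) X \<inter> {..<n} = ev p X"
    by metis
  have inj: "inj_on \<Phi> {p. p permutes S}"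
  proof (rule inj_onI)
    fix p p' assume p: "p \<in> {p. p permutes S}" "p' \<in> {p. p permutes S}" "\<Phi> p = \<Phi> p'"
    show "p = p'"
    proof
      fix X
      show "p X = p' X"
      proof (cases "X \<in> S")
        case True
        then have "X \<subseteq> {..<n}" by (auto simp: S_def)
        then have "ev p X = ev p' X" using \<Phi>(3)[of p X] \<Phi>(3)[of p' X] p by simp
        then show ?thesis using ev_S[OF True] by simp
      next
        case False
        then show ?thesis using p permutes_not_in by (metis mem_Collect_eq)
      qed
    qed
  qed
  have "finite S" by (simp add: S_def)
  then have "fact (2 ^ n - 2) = card {p. p permutes S}" using card_permutations[OF cS] by simp
  also have "\<dots> \<le> card {c. valid_circuit (n + q) c \<and> length c \<le> L}"
    by (rule card_inj_on_le[OF inj _ card_short_circuits_le(1)]) (use \<Phi> in auto)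
  also have "\<dots> \<le> ((n + q + 1) ^ 3 + 1) ^ L" by (rule card_short_circuits_le(2))
  finally show ?thesis .
qed

section \<open>The Shannon function as an attained maximum\<close>

lemma Fset_nonempty: "Fset n q \<noteq> {}"
proof -
  have "implements n q [] (\<lambda>xs. take n (run_circuit [] (xs @ replicate q False)))"
    by (simp add: implements_iff)
  then show ?thesis by (auto simp: Fset_def)
qed

text \<open>A uniform bound makes the set of complexities finite, so that \<open>Sup\<close> on the
  naturals is a genuine maximum.\<close>

lemma shannon_L_attained:
  assumes "\<And>f. f \<in> Fset n q \<Longrightarrow> complexity n q f \<le> K"
  shows "\<exists>f\<in>Fset n q. shannon_L n q = complexity n q f"
    and "f \<in> Fset n q \<Longrightarrow> complexity n q f \<le> shannon_L n q"
proof -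
  have fin: "finite (complexity n q ` Fset n q)"
    by (rule finite_subset[of _ "{..K}"]) (use assms in auto)
  have ne: "complexity n q ` Fset n q \<noteq> {}" using Fset_nonempty by blast
  have eq: "shannon_L n q = Max (complexity n q ` Fset n q)"
    using ne by (simp add: shannon_L_def Sup_nat_def)
  show "\<exists>f\<in>Fset n q. shannon_L n q = complexity n q f" using Max_in[OF fin ne] eq by auto
  show "f \<in> Fset n q \<Longrightarrow> complexity n q f \<le> shannon_L n q" using Max_ge[OF fin] eq by simp
qed

lemma complexity_bounded:
  assumes "4096 \<le> n" "f \<in> Fset n q" shows "complexity n q f \<le> 224 * n * (2 ^ (n + 2) + 12)"
  using complexity_upper[of 1 n f q] assms by simp

text \<open>The factorial contains \<open>b\<close> factors larger than \<open>a\<close>; this crude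
  bound stands in for Stirling's formula.\<close>

lemma power_le_fact_add: "a ^ b \<le> (fact (a + b) :: nat)"
proof (induction b)
  case (Suc b)
  have "a ^ Suc b \<le> Suc (a + b) * fact (a + b)"
    unfolding power_Suc by (rule mult_mono) (use Suc in auto)
  then show ?case by simp
qed simp

text \<open>With \<open>k = n - 2\<close>, counting gives
  \<open>2 ^ (k * 2 ^ k) \<le> n ^ (9 * L)\<close>, the 9 coming from the base
  \<open>(n ^ 3) ^ 3\<close> of the circuit count; then logarithms are taken.\<close>

lemma shannon_L_lower:
  assumes n: "4096 \<le> n" and q: "n + q + 2 \<le> n ^ 3"
  shows "1 / 72 * (real n * 2 ^ n / log 2 (real n)) \<le> real (shannon_L n q)"
proof -
  define L where "L = shannon_L n q"
  define k where "k = n - 2"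
  have nk: "n = k + 2" using n by (simp add: k_def)
  have "(2::nat) ^ 1 \<le> 2 ^ k" using n by (intro power_increasing) (auto simp: k_def)
  then have k2: "(2::nat) \<le> 2 ^ k" by simp
  have "(2 ^ k) ^ (2 ^ k) \<le> (fact (2 ^ k + 2 ^ k) :: nat)" by (rule power_le_fact_add)
  also have "\<dots> \<le> fact (2 ^ n - 2)" using k2 by (intro fact_mono) (simp add: nk power_add)
  also have "\<dots> \<le> ((n + q + 1) ^ 3 + 1) ^ L"
    unfolding L_def by (rule fact_le_circuit_count[OF n])
      (rule shannon_L_attained(2)[OF complexity_bounded[OF n]])
  also have "\<dots> \<le> ((n ^ 3) ^ 3) ^ L"
  proof (rule power_mono)
    have "(n + q + 1) ^ 3 < (n + q + 2) ^ 3" by (rule power_strict_mono) auto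
    also have "\<dots> \<le> (n ^ 3) ^ 3" by (rule power_mono[OF q]) simp
    finally show "(n + q + 1) ^ 3 + 1 \<le> (n ^ 3) ^ 3" by simp
  qed simp
  also have "\<dots> = n ^ (9 * L)" by (simp add: power_mult[symmetric])
  finally have "2 ^ (k * 2 ^ k) \<le> n ^ (9 * L)" by (simp add: power_mult)
  then have "real (2 ^ (k * 2 ^ k)) \<le> real (n ^ (9 * L))" by (rule of_nat_mono)
  then have le: "(2::real) ^ (k * 2 ^ k) \<le> real n ^ (9 * L)" by simp
  have "log 2 ((2::real) ^ (k * 2 ^ k)) \<le> log 2 (real n ^ (9 * L))"
    using le n by (subst log_le_cancel_iff) auto
  then have "real (k * 2 ^ k) \<le> real (9 * L) * log 2 (real n)"
    using n by (simp add: log_nat_power)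
  \<comment> \<open>\<open>k \<ge> n / 2\<close> and \<open>2 ^ k = 2 ^ n / 4\<close> give the 8 in
    \<open>72 = 8 * 9\<close>.\<close>
  moreover have "real n / 8 * 2 ^ n \<le> real (k * 2 ^ k)"
  proof -
    have "real n / 8 * 2 ^ n = real n / 2 * 2 ^ k" by (simp add: nk power_add)
    also have "\<dots> \<le> real k * 2 ^ k" using n by (intro mult_right_mono) (auto simp: nk)
    finally show ?thesis by simp
  qed
  moreover have "0 < log 2 (real n)" using n by simp
  ultimately show ?thesis by (simp add: L_def field_simps)
qed

section \<open>Asymptotics\<close>

text \<open>The first condition reads \<open>2 ^ (6 * 2 ^ r) \<le> n\<close>, so
  \<open>2 ^ r\<close> is taken as the largest power of two not exceeding
  \<open>log 2 n / 6\<close>; maximality gives \<open>12 = 2 * 6\<close>.\<close>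

lemma exists_block_exponent:
  assumes n: "4096 \<le> n"
  shows "\<exists>r\<ge>1. (2 ^ 2 ^ (r + 1)) ^ 3 \<le> n \<and> log 2 (real n) \<le> 12 * 2 ^ r"
proof -
  define y where "y = nat \<lfloor>log 2 (real n) / 6\<rfloor>"
  have "2 powr 12 \<le> real n" using n by simp
  then have l12: "12 \<le> log 2 (real n)" using n by (subst le_log_iff) auto
  then have "2 \<le> \<lfloor>log 2 (real n) / 6\<rfloor>" by (simp add: le_floor_iff)
  then have y2: "2 \<le> y" unfolding y_def by linarith
  have fl: "real y = of_int \<lfloor>log 2 (real n) / 6\<rfloor>"
    using \<open>2 \<le> \<lfloor>log 2 (real n) / 6\<rfloor>\<close> unfolding y_def by simp
  have y: "real y \<le> log 2 (real n) / 6" "log 2 (real n) / 6 < real y + 1"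
    unfolding fl by linarith+
  obtain r where r: "2 ^ r \<le> y" "y < 2 ^ (r + 1)" using ex_power_ivl1[of 2 y] y2 by auto
  have "r \<ge> 1" using r y2 by (cases r) auto
  moreover have "(2 ^ 2 ^ (r + 1)) ^ 3 \<le> n"
  proof -
    have "real (2 ^ r) \<le> real y" using r(1) by (rule of_nat_mono)
    moreover have "real (6 * 2 ^ r) = 6 * real (2 ^ r)" by simp
    ultimately have "real (6 * 2 ^ r) \<le> log 2 (real n)" using y(1) by linarith
    then have "2 powr real (6 * 2 ^ r) \<le> 2 powr log 2 (real n)" by simp
    also have "\<dots> = real n" using n by simp
    finally have "(2::real) ^ (6 * 2 ^ r) \<le> real n" by (simp add: powr_realpow del: of_nat_mult of_nat_power)
    then have "real (2 ^ (6 * 2 ^ r)) \<le> real n" by simp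
    then have "2 ^ (6 * 2 ^ r) \<le> n" by (simp only: of_nat_le_iff)
    moreover have "((2::nat) ^ 2 ^ (r + 1)) ^ 3 = 2 ^ (6 * 2 ^ r)"
      by (simp add: power_mult[symmetric] mult.commute)
    ultimately show ?thesis by simp
  qed
  moreover have "log 2 (real n) \<le> 12 * 2 ^ r"
  proof -
    have "y + 1 \<le> 2 ^ (r + 1)" using r(2) by simp
    then have "real (y + 1) \<le> real (2 ^ (r + 1))" by (rule of_nat_mono)
    moreover have "real (2 ^ (r + 1)) = 2 * 2 ^ r" "real (y + 1) = real y + 1" by simp_all
    ultimately show ?thesis using y(2) by linarith
  qed
  ultimately show ?thesis by blast
qed

lemma shannon_L_upper:
  assumes n: "4096 \<le> n"
  shows "real (shannon_L n q) \<le> 13440 * (real n * 2 ^ n / log 2 (real n))"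
proof -
  obtain r where r: "1 \<le> r" "(2 ^ 2 ^ (r + 1)) ^ 3 \<le> n" "log 2 (real n) \<le> 12 * 2 ^ r"
    using exists_block_exponent[OF n] by blast
  define L where "L = shannon_L n q"
  obtain f where f: "f \<in> Fset n q" "L = complexity n q f"
    using shannon_L_attained(1)[OF complexity_bounded[OF n]] unfolding L_def by blast
  have "2 ^ r * L \<le> 224 * n * (2 ^ (n + 2) + 3 * 2 ^ r * 2 ^ r)"
    unfolding f(2) by (rule complexity_upper[OF r(1,2) f(1)])
  \<comment> \<open>The remainder is negligible: \<open>3 * 2 ^ r * 2 ^ r \<le> 2 ^ (2 + 2 * r)
    \<le> 2 ^ (6 * 2 ^ r) \<le> n \<le> 2 ^ n\<close>.\<close>
  also have "\<dots> \<le> 224 * n * (5 * 2 ^ n)"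
  proof (rule mult_le_mono2)
    have "r < 2 ^ r" by (rule less_exp)
    moreover have "2 ^ (r + 1) * 3 = (6 * 2 ^ r :: nat)" by simp
    ultimately have "2 + r + r \<le> 2 ^ (r + 1) * 3" using r(1) by linarith
    then have "(2::nat) ^ (2 + r + r) \<le> 2 ^ (2 ^ (r + 1) * 3)" by (rule power_increasing) simp
    also have "\<dots> \<le> n" unfolding power_mult by (rule r(2))
    also have "\<dots> \<le> 2 ^ n" by simp
    finally show "2 ^ (n + 2) + 3 * 2 ^ r * 2 ^ r \<le> (5 * 2 ^ n :: nat)" by (simp add: power_add)
  qed
  also have "\<dots> = 1120 * n * 2 ^ n" by simp
  finally have "real (2 ^ r * L) \<le> real (1120 * n * 2 ^ n)" by (rule of_nat_mono)
  then have "2 ^ r * real L \<le> 1120 * real n * 2 ^ n" by simp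
  moreover have "log 2 (real n) * real L \<le> 12 * 2 ^ r * real L" using r(3) by (rule mult_right_mono) simp
  \<comment> \<open>\<open>13440 = 12 * 1120\<close>, where 12 compares \<open>log 2 n\<close> with
    \<open>2 ^ r\<close>.\<close>
  ultimately have "log 2 (real n) * real L \<le> 13440 * (real n * 2 ^ n)" by linarith
  moreover have "0 < log 2 (real n)" using n by simp
  ultimately show ?thesis by (simp add: L_def field_simps)
qed

theorem theorem2:
  fixes q :: "nat \<Rightarrow> nat"
  assumes "(\<lambda>n. real (q n)) \<in> O(\<lambda>n. real n ^ 2)"
  shows "\<exists>c1 c2::real. 0 < c1 \<and> c1 \<le> c2 \<and>
    (\<forall>\<^sub>F n in sequentially.
       c1 * (real n * 2 ^ n / log 2 (real n)) \<le> real (shannon_L n (q n)) \<and>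
       real (shannon_L n (q n)) \<le> c2 * (real n * 2 ^ n / log 2 (real n)))"
proof (intro exI conjI)
  obtain C where C: "C > 0" "\<forall>\<^sub>F n in sequentially. norm (real (q n)) \<le> C * norm (real n ^ 2)"
    using landau_o.bigE[OF assms] by blast
  have "\<forall>\<^sub>F n in sequentially. n \<ge> max 4096 (nat \<lceil>C\<rceil> + 2)" by (rule eventually_ge_at_top)
  with C(2) have "\<forall>\<^sub>F n in sequentially. 4096 \<le> n \<and> n + q n + 2 \<le> n ^ 3"
  proof eventually_elim
    case (elim n)
    have n: "4096 \<le> n" "C + 2 \<le> real n" using elim(2) by linarith+
    have "real (q n) \<le> C * real n ^ 2" using elim(1) by simp
    \<comment> \<open>Taking \<open>n \<ge> C + 2\<close> leaves \<open>2 * n ^ 2\<close> out of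
      \<open>n ^ 3\<close>, enough to absorb \<open>n + 2\<close>.\<close>
    also have "\<dots> \<le> (real n - 2) * real n ^ 2" using n by (intro mult_right_mono) auto
    finally have "real (q n) + 2 * real n ^ 2 \<le> real n ^ 3"
      by (simp add: power2_eq_square power3_eq_cube algebra_simps)
    moreover have "real n + 2 \<le> 2 * real n ^ 2"
    proof -
      have "real n * 1 \<le> real n * real n" using n by (intro mult_left_mono) auto
      then show ?thesis using n unfolding power2_eq_square by linarith
    qed
    ultimately have "real (n + q n + 2) \<le> real (n ^ 3)" by simp
    then show ?case using n(1) by (simp only: of_nat_le_iff)
  qed
  then show "\<forall>\<^sub>F n in sequentially.
       1 / 72 * (real n * 2 ^ n / log 2 (real n)) \<le> real (shannon_L n (q n)) \<and>
       real (shannon_L n (q n)) \<le> 13440 * (real n * 2 ^ n / log 2 (real n))"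
    by eventually_elim (use shannon_L_lower shannon_L_upper in blast)
qed simp_all

end
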